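(* Let $\mathcal{H}=(V,H)$ be a boolean representable simplicial complex of dimension $2$. Then the following conditions are equivalent: (i) $\mathcal{H}$ is shellable; (ii) $\mathcal{H}$ is sequentially Cohen-Macaulay; (iii) the graph of flats $\Gamma\mathrm{Fl}\mathcal{H}_S$ of the simplification $\mathcal{H}_S$ contains at most two connected components or contains exactly one nontrivial connected component.
   Context: A (finite) simplicial complex is a pair $\mathcal{H}=(V,H)$ where $V$ is a finite nonempty set and $H\subseteq 2^V$ contains all singletons and is closed under taking subsets; elements of $H$ are faces, maximal faces are facets, the dimension of a face $I$ is $|I|-1$, $\dim\mathcal{H}$ is the maximum dimension of a face, and $\mathcal{H}$ is pure if all facets have the same dimension. $P_n(V)$ is the set of $n$-subsets of $V$ and $pq$ denotes $\{p,q\}$. A boolean matrix with row set $R$ and column set $V$ is nonsingular if, after independently permuting rows and columns, it is square lower unitriangular; $X\subseteq V$ is $M$-independent if some submatrix $M[Y,X]$ ($Y\subseteq R$) is nonsingular; $\mathcal{H}$ is boolean representable if $H$ is the set of $M$-independent subsets for some boolean matrix $M$. A flat is a set $X\subseteq V$ such that $I\cup\{p\}\in H$ for all $I\in H$ with $I\subseteq X$ and all $p\in V\setminus X$; $\overline{X}$ is the intersection of all flats containing $X$. The graph of flats $\Gamma\mathrm{Fl}\mathcal{H}$ has vertex set $V$ and edges $p - q$ for $p\neq q$ with $\overline{pq}\neq V$; a connected component is nontrivial if it has more than one vertex. The equivalence relation $\eta$ on $V$ is $a\,\eta\, b$ iff $\overline{\{a\}}=\overline{\{b\}}$. For an equivalence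 relation $\tau$ on $V$, $\mathcal{H}/\tau=(V/\tau,H/\tau)$ with $H/\tau=\{\{a_1\tau,\ldots,a_k\tau\}: a_1\ldots a_k\in H\}$; the simplification is $\mathcal{H}_S=\mathcal{H}/\eta$. Shellable: the facets can be ordered $B_1,\ldots,B_t$ so that for $k=2,\ldots,t$, setting $I(B_k)=(\bigcup_{i=1}^{k-1}2^{B_i})\cap 2^{B_k}$, the complex $(B_k,I(B_k))$ is pure of dimension $|B_k|-2$ whenever $|B_k|\geq 2$. For $Q\in H$, $Q\neq V$, the link $\mathrm{lk}(Q)$ is the complex with faces $\{X\subseteq V\setminus Q: X\cup Q\in H\}$ (vertex set the union of these faces; empty vertex sets allowed). For $m\le\dim\mathcal{H}$, $\mathrm{pure}_m(\mathcal{H})$ is the subcomplex generated by all $m$-dimensional faces. If $\dim\mathcal{H}=d$, $\mathcal{H}$ is sequentially Cohen-Macaulay if $\tilde H_k(\mathrm{pure}_m(\mathrm{lk}(X)))=0$ for all $X\in H$ and all $k<m\leq d$, where $\tilde H_k$ is reduced simplicial homology. *)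

theory Defs
  imports "HOL-Algebra.Elementary_Groups"
begin

section \<open>Simplicial complexes\<close>

definition simplicial_complex :: "'a set \<Rightarrow> 'a set set \<Rightarrow> bool" where
  "simplicial_complex V H \<longleftrightarrow>
     finite V \<and> V \<noteq> {} \<and> H \<subseteq> Pow V \<and> (\<forall>v\<in>V. {v} \<in> H) \<and> (\<forall>I\<in>H. \<forall>J\<subseteq>I. J \<in> H)"

text \<open>
  The notions from here up to reduced homology depend only on the set of faces, so they are
  stated for a family \<open>K\<close> of faces alone. For links, and for the complexes
  \<open>(B\<^sub>k, I(B\<^sub>k))\<close> in the definition of shellability, not every vertex need be a face.
\<close>

definition facets :: "'a set set \<Rightarrow> 'a set set" where
  "facets K = {F \<in> K. \<forall>G\<in>K. F \<subseteq> G \<longrightarrow> F = G}"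

definition face_dim :: "'a set \<Rightarrow> int" where
  "face_dim I = int (card I) - 1"

text \<open>Meaningful for finite nonempty \<open>K\<close> only; the dimension of \<open>{{}}\<close> is \<open>-1\<close>.\<close>

definition sc_dim :: "'a set set \<Rightarrow> int" where
  "sc_dim K = Max (face_dim ` K)"

definition sc_pure :: "'a set set \<Rightarrow> bool" where
  "sc_pure K \<longleftrightarrow> (\<forall>F\<in>facets K. \<forall>G\<in>facets K. face_dim F = face_dim G)"

definition shellable :: "'a set set \<Rightarrow> bool" where
  "shellable H \<longleftrightarrow>
     (\<exists>Bs. distinct Bs \<and> set Bs = facets H \<and>
        (\<forall>k. 1 \<le> k \<and> k < length Bs \<and> card (Bs ! k) \<ge> 2 \<longrightarrow>
           (let I = (\<Union>i<k. Pow (Bs ! i)) \<inter> Pow (Bs ! k)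
            in sc_pure I \<and> sc_dim I = int (card (Bs ! k)) - 2)))"

definition link :: "'a set \<Rightarrow> 'a set set \<Rightarrow> 'a set \<Rightarrow> 'a set set" where
  "link V H Q = {X. X \<subseteq> V - Q \<and> X \<union> Q \<in> H}"

text \<open>If \<open>K\<close> has no \<open>m\<close>-dimensional face, this is the void complex, which has no faces at all
  (not even the empty one) and whose reduced homology vanishes in every degree.\<close>

definition pure_part :: "int \<Rightarrow> 'a set set \<Rightarrow> 'a set set" where
  "pure_part m K = {X. \<exists>F\<in>K. face_dim F = m \<and> X \<subseteq> F}"


section \<open>Reduced simplicial homology with integer coefficients\<close>

text \<open>
  An oriented \<open>k\<close>-chain is an integer-valued function on the orderings
  \<open>[v\<^sub>0, \<dots>, v\<^sub>k]\<close> of the \<open>k\<close>-dimensional faces that changes sign under transpositions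
  (adjacent ones suffice); it is extended by \<open>0\<close> to all other lists. The elementary chain of an
  oriented simplex has value \<open>1\<close> on the even and \<open>-1\<close> on the odd rearrangements of it.
  The only ordering of the empty face is the empty list, so the chains in degree \<open>-1\<close> are the
  integers (if the empty set is a face), and there are no nonzero chains in degrees below \<open>-1\<close>.
\<close>

definition simplicial_chains :: "'a set set \<Rightarrow> int \<Rightarrow> ('a list \<Rightarrow> int) set" where
  "simplicial_chains K k =
     {c. (\<forall>xs. c xs \<noteq> 0 \<longrightarrow> distinct xs \<and> set xs \<in> K \<and> face_dim (set xs) = k) \<and>
         (\<forall>xs x y ys. c (xs @ x # y # ys) = - c (xs @ y # x # ys))}"

definition simplicial_chain_group :: "'a set set \<Rightarrow> int \<Rightarrow> ('a list \<Rightarrow> int) monoid" where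
  "simplicial_chain_group K k =
     \<lparr>carrier = simplicial_chains K k, mult = (\<lambda>c d xs. c xs + d xs), one = (\<lambda>xs. 0)\<rparr>"

text \<open>
  In terms of coefficients, \<open>\<partial>[v\<^sub>0, \<dots>, v\<^sub>k] = \<Sum>i. (-1)^i [v\<^sub>0, \<dots>, v\<^sub>i\<^sub>-\<^sub>1, v\<^sub>i\<^sub>+\<^sub>1, \<dots>, v\<^sub>k]\<close> says that
  the value of \<open>\<partial>c\<close> at an oriented simplex \<open>xs\<close> is the sum of the values of \<open>c\<close> at all
  \<open>v # xs\<close>. In degree \<open>0\<close> this is the augmentation map.
\<close>

definition simplicial_boundary :: "'a set set \<Rightarrow> ('a list \<Rightarrow> int) \<Rightarrow> ('a list \<Rightarrow> int)" where
  "simplicial_boundary K c = (\<lambda>xs. \<Sum>v\<in>\<Union>K. c (v # xs))"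

definition simplicial_cycles :: "'a set set \<Rightarrow> int \<Rightarrow> ('a list \<Rightarrow> int) set" where
  "simplicial_cycles K k =
     kernel (simplicial_chain_group K k) (simplicial_chain_group K (k - 1)) (simplicial_boundary K)"

definition simplicial_boundaries :: "'a set set \<Rightarrow> int \<Rightarrow> ('a list \<Rightarrow> int) set" where
  "simplicial_boundaries K k = simplicial_boundary K ` simplicial_chains K (k + 1)"

definition reduced_homology :: "'a set set \<Rightarrow> int \<Rightarrow> ('a list \<Rightarrow> int) set monoid" where
  "reduced_homology K k =
     (simplicial_chain_group K k)\<lparr>carrier := simplicial_cycles K k\<rparr> Mod simplicial_boundaries K k"

definition sequentially_Cohen_Macaulay :: "'a set \<Rightarrow> 'a set set \<Rightarrow> bool" where
  "sequentially_Cohen_Macaulay V H \<longleftrightarrow>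
     (\<forall>X\<in>H. \<forall>k m. k < m \<and> m \<le> sc_dim H \<longrightarrow>
        trivial_group (reduced_homology (pure_part m (link V H X)) k))"


section \<open>Boolean representability\<close>

text \<open>\<open>M r v\<close> says that the entry in row \<open>r\<close> and column \<open>v\<close> is \<open>1\<close>; the empty matrix is
  nonsingular.\<close>

definition nonsingular :: "('r \<Rightarrow> 'a \<Rightarrow> bool) \<Rightarrow> 'r set \<Rightarrow> 'a set \<Rightarrow> bool" where
  "nonsingular M Y X \<longleftrightarrow>
     (\<exists>n r c. bij_betw r {..<n::nat} Y \<and> bij_betw c {..<n} X \<and>
        (\<forall>i<n. M (r i) (c i)) \<and> (\<forall>i j. i < j \<and> j < n \<longrightarrow> \<not> M (r i) (c j)))"

definition matrix_independent :: "('r \<Rightarrow> 'a \<Rightarrow> bool) \<Rightarrow> 'r set \<Rightarrow> 'a set \<Rightarrow> bool" where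
  "matrix_independent M R X \<longleftrightarrow> (\<exists>Y\<subseteq>R. nonsingular M Y X)"

text \<open>The rows of the representing matrix are labelled by natural numbers, which is no
  restriction on a finite matrix.\<close>

definition boolean_representable :: "'a set \<Rightarrow> 'a set set \<Rightarrow> bool" where
  "boolean_representable V H \<longleftrightarrow>
     (\<exists>(M :: nat \<Rightarrow> 'a \<Rightarrow> bool) R. finite R \<and> H = {X. X \<subseteq> V \<and> matrix_independent M R X})"


section \<open>Flats, graph of flats, simplification\<close>

definition is_flat :: "'a set \<Rightarrow> 'a set set \<Rightarrow> 'a set \<Rightarrow> bool" where
  "is_flat V H X \<longleftrightarrow> X \<subseteq> V \<and> (\<forall>I\<in>H. I \<subseteq> X \<longrightarrow> (\<forall>p\<in>V - X. I \<union> {p} \<in> H))"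

definition flat_closure :: "'a set \<Rightarrow> 'a set set \<Rightarrow> 'a set \<Rightarrow> 'a set" where
  "flat_closure V H X = \<Inter> {F. is_flat V H F \<and> X \<subseteq> F}"

definition graph_of_flats :: "'a set \<Rightarrow> 'a set set \<Rightarrow> ('a \<times> 'a) set" where
  "graph_of_flats V H = {(p, q). p \<in> V \<and> q \<in> V \<and> p \<noteq> q \<and> flat_closure V H {p, q} \<noteq> V}"

text \<open>Connected components, as vertex sets, of the graph with vertex set \<open>V\<close> and symmetric
  edge relation \<open>E\<close>.\<close>

definition graph_components :: "'a set \<Rightarrow> ('a \<times> 'a) set \<Rightarrow> 'a set set" where
  "graph_components V E = V // {(p, q). p \<in> V \<and> q \<in> V \<and> (p, q) \<in> E\<^sup>*}"

definition nontrivial_components :: "'a set \<Rightarrow> ('a \<times> 'a) set \<Rightarrow> 'a set set" where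
  "nontrivial_components V E = {C \<in> graph_components V E. card C > 1}"

definition eta :: "'a set \<Rightarrow> 'a set set \<Rightarrow> ('a \<times> 'a) set" where
  "eta V H = {(a, b). a \<in> V \<and> b \<in> V \<and> flat_closure V H {a} = flat_closure V H {b}}"

text \<open>The quotient of \<open>(V, H)\<close> by \<open>\<tau>\<close> is \<open>(V // \<tau>, quotient_faces H \<tau>)\<close>; here \<open>I // \<tau>\<close> is the
  set of classes of the elements of \<open>I\<close>.\<close>

definition quotient_faces :: "'a set set \<Rightarrow> ('a \<times> 'a) set \<Rightarrow> 'a set set set" where
  "quotient_faces H \<tau> = (\<lambda>I. I // \<tau>) ` H"

definition simplification_vertices :: "'a set \<Rightarrow> 'a set set \<Rightarrow> 'a set set" where
  "simplification_vertices V H = V // eta V H"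

definition simplification_faces :: "'a set \<Rightarrow> 'a set set \<Rightarrow> 'a set set set" where
  "simplification_faces V H = quotient_faces H (eta V H)"

end

theory Submission
  imports Defs
begin

text \<open>
  Call \<open>p\<close> and \<open>q\<close> adjacent if \<open>{p, q}\<close> is a face whose closure is a proper flat. In
  dimension 2 the proper flats containing an edge behave like lines: two points on an edge lie on
  at most one of them, and a triangle is a face iff it consists of two adjacent points and a point
  off their line. Adjacency on \<open>V\<close> is the pullback of the graph of flats of the simplification,
  so the components can be discussed on \<open>V\<close>.

  If there are three components, two of them nontrivial, then no triangle meets three components.
  So the antisymmetric function that counts the edges from the first nontrivial component to the
  second is a cocycle on the pure 2-skeleton, and it does not vanish on a cycle of length three
  through three components. Hence the first homology of the pure 2-skeleton is nonzero, which
  excludes both sequential Cohen-Macaulayness and shellability (along a shelling of the triangles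
  all 1-cycles bound).

  Otherwise the vertices can be added one by one, starting from a triangle: first vertices adjacent
  to a previous one, then isolated vertices. At every step the edges of the link of the new vertex
  form a connected graph and lie in triangles already present, so that a shelling of the triangles
  extends. The edges that lie in no triangle are appended at the end. The same description of the
  links shows that they are connected, which gives sequential Cohen-Macaulayness.
\<close>

section \<open>Shellings of families of triangles\<close>

text \<open>Shellability of a pure 2-dimensional complex, as a property of its set of triangles with
  the order forgotten. The last premise says that \<open>T\<close> meets the earlier triangles in a
  union of edges; it is vacuous for the first triangle.\<close>

inductive tshell :: "'a set set \<Rightarrow> bool" where
  empty: "tshell {}"
| insert: "tshell S \<Longrightarrow> T \<notin> S \<Longrightarrow> card T = 3 \<Longrightarrow>
    (\<And>A. A \<in> S \<Longrightarrow> \<exists>B\<in>S. A \<inter> T \<subseteq> B \<and> card (B \<inter> T) = 2) \<Longrightarrow> tshell (insert T S)"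

text \<open>The exchange form of the shelling condition: each intersection with an earlier set lies
  in such an intersection of codimension one. Unlike purity it can be checked pair by pair, also for
  facets of mixed dimension.\<close>

definition shelling_list :: "'a set list \<Rightarrow> bool" where
  "shelling_list Bs \<longleftrightarrow> distinct Bs \<and>
     (\<forall>k<length Bs. \<forall>i<k. \<exists>l<k. Bs ! i \<inter> Bs ! k \<subseteq> Bs ! l \<and>
        Suc (card (Bs ! l \<inter> Bs ! k)) = card (Bs ! k))"

lemma shelling_list_snoc:
  assumes "shelling_list Bs" "T \<notin> set Bs"
    and "\<And>A. A \<in> set Bs \<Longrightarrow> \<exists>B\<in>set Bs. A \<inter> T \<subseteq> B \<and> Suc (card (B \<inter> T)) = card T"
  shows "shelling_list (Bs @ [T])"
  unfolding shelling_list_def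
proof (intro conjI allI impI)
  show "distinct (Bs @ [T])" using assms by (auto simp: shelling_list_def)
  fix k i assume k: "k < length (Bs @ [T])" and i: "i < k"
  show "\<exists>l<k. (Bs @ [T]) ! i \<inter> (Bs @ [T]) ! k \<subseteq> (Bs @ [T]) ! l \<and>
      Suc (card ((Bs @ [T]) ! l \<inter> (Bs @ [T]) ! k)) = card ((Bs @ [T]) ! k)"
  proof (cases "k < length Bs")
    case True
    then obtain l where "l < k" "Bs ! i \<inter> Bs ! k \<subseteq> Bs ! l" "Suc (card (Bs ! l \<inter> Bs ! k)) = card (Bs ! k)"
      using assms(1) i unfolding shelling_list_def by blast
    then show ?thesis using True i by (intro exI[of _ l]) (auto simp: nth_append)
  next
    case False
    then have kk: "k = length Bs" using k by simp
    then obtain B where "B \<in> set Bs" "Bs ! i \<inter> T \<subseteq> B" "Suc (card (B \<inter> T)) = card T"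
      using assms(3)[of "Bs ! i"] i by auto
    moreover then obtain l where "l < length Bs" "B = Bs ! l" by (auto simp: in_set_conv_nth)
    ultimately show ?thesis using kk i by (intro exI[of _ l]) (auto simp: nth_append)
  qed
qed

lemma tshell_imp_shelling_list:
  "tshell S \<Longrightarrow> \<exists>Bs. set Bs = S \<and> shelling_list Bs"
proof (induction rule: tshell.induct)
  case empty
  show ?case by (intro exI[of _ "[]"]) (simp add: shelling_list_def)
next
  case (insert S T)
  then obtain Bs where Bs: "set Bs = S" "shelling_list Bs" by blast
  then have "shelling_list (Bs @ [T])"
    using insert.hyps by (intro shelling_list_snoc) fastforce+
  then show ?case using Bs(1) by (intro exI[of _ "Bs @ [T]"]) simp
qed

text \<open>The complex \<open>I\<close> is generated by the sets
  \<open>Bs ! i \<inter> Bs ! k\<close> with \<open>i < k\<close>, so its facets are among them, and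
  it is pure of the required dimension iff each of them lies in one with a single vertex of
  \<open>Bs ! k\<close> missing. The assumption \<open>k \<ge> 1\<close> puts the empty face into
  \<open>I\<close>, so that \<open>sc_dim\<close> is a maximum over a nonempty set.\<close>

lemma face_pure_boundary_iff:
  fixes Bs :: "'a set list"
  assumes "k \<ge> 1" "finite (Bs ! k)" "card (Bs ! k) \<ge> 2"
    and I: "I = (\<Union>i<k. Pow (Bs ! i)) \<inter> Pow (Bs ! k)"
  shows "(sc_pure I \<and> sc_dim I = int (card (Bs ! k)) - 2) \<longleftrightarrow>
    (\<forall>i<k. \<exists>l<k. Bs ! i \<inter> Bs ! k \<subseteq> Bs ! l \<and> Suc (card (Bs ! l \<inter> Bs ! k)) = card (Bs ! k))"
    (is "?L \<longleftrightarrow> ?R")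
proof
  have finI: "finite I" and sub: "\<And>X. X \<in> I \<Longrightarrow> finite X"
    using assms(2) by (auto simp: I intro: finite_subset)
  have "{} \<in> I" using assms(1) by (auto simp: I intro!: exI[of _ 0])
  then have ne: "I \<noteq> {}" by blast
  have ex_facet: "\<exists>Y\<in>facets I. X \<subseteq> Y" if "X \<in> I" for X
    using finite_has_maximal2[OF finI that] by (auto simp: facets_def)
  {
    assume L: ?L
    show ?R
    proof (intro allI impI)
      fix i assume "i < k"
      then have "Bs ! i \<inter> Bs ! k \<in> I" by (auto simp: I)
      then obtain Y where Y: "Y \<in> facets I" "Bs ! i \<inter> Bs ! k \<subseteq> Y" using ex_facet by blast
      \<comment> \<open>A face of maximal dimension extends to a facet \<open>Z'\<close> of that
        dimension; purity transfers the dimension from \<open>Z'\<close> to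
        \<open>Y\<close>.\<close>
      have "sc_dim I \<in> face_dim ` I" unfolding sc_dim_def using finI ne by (intro Max_in) auto
      then obtain Z where Z: "Z \<in> I" "face_dim Z = sc_dim I" by auto
      then obtain Z' where Z': "Z' \<in> facets I" "Z \<subseteq> Z'" using ex_facet by blast
      have "face_dim Z' \<le> sc_dim I" unfolding sc_dim_def using finI Z' by (intro Max_ge) (auto simp: facets_def)
      moreover have "face_dim Z \<le> face_dim Z'"
        using Z' card_mono[OF sub[of Z'] Z'(2)] by (auto simp: face_dim_def facets_def)
      ultimately have "face_dim Z' = sc_dim I" using Z by simp
      then have dY: "face_dim Y = int (card (Bs ! k)) - 2" using L Y(1) Z'(1) unfolding sc_pure_def by metis
      from Y(1) obtain l where l: "l < k" "Y \<subseteq> Bs ! l" "Y \<subseteq> Bs ! k" by (auto simp: facets_def I)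
      then have "Bs ! l \<inter> Bs ! k \<in> I" by (auto simp: I)
      then have "Y = Bs ! l \<inter> Bs ! k" using Y(1) l by (auto simp: facets_def)
      then show "\<exists>l<k. Bs ! i \<inter> Bs ! k \<subseteq> Bs ! l \<and> Suc (card (Bs ! l \<inter> Bs ! k)) = card (Bs ! k)"
        using l Y(2) dY assms(3) by (intro exI[of _ l]) (auto simp: face_dim_def)
    qed
  next
    assume R: ?R
    have *: "\<exists>Y\<in>I. X \<subseteq> Y \<and> Suc (card Y) = card (Bs ! k)" if "X \<in> I" for X
    proof -
      from that obtain i where i: "i < k" "X \<subseteq> Bs ! i" "X \<subseteq> Bs ! k" by (auto simp: I)
      then obtain l where "l < k" "Bs ! i \<inter> Bs ! k \<subseteq> Bs ! l" "Suc (card (Bs ! l \<inter> Bs ! k)) = card (Bs ! k)"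
        using R by blast
      then show ?thesis using i by (intro bexI[of _ "Bs ! l \<inter> Bs ! k"]) (auto simp: I)
    qed
    have fd: "face_dim X = int (card (Bs ! k)) - 2" if X: "X \<in> facets I" for X
    proof -
      have "X \<in> I" using X by (simp add: facets_def)
      then obtain Y where "Y \<in> I" "X \<subseteq> Y" "Suc (card Y) = card (Bs ! k)" using * by blast
      moreover then have "X = Y" using X by (auto simp: facets_def)
      ultimately show ?thesis by (simp add: face_dim_def)
    qed
    have "sc_dim I = int (card (Bs ! k)) - 2"
      unfolding sc_dim_def
    proof (rule Max_eqI)
      show "finite (face_dim ` I)" using finI by simp
      fix y assume "y \<in> face_dim ` I"
      then obtain X where "X \<in> I" "y = face_dim X" by auto
      moreover then obtain Y where "Y \<in> I" "X \<subseteq> Y" "Suc (card Y) = card (Bs ! k)" using * by blast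
      ultimately show "y \<le> int (card (Bs ! k)) - 2"
        using card_mono[OF sub[of Y], of X] by (simp add: face_dim_def)
    next
      obtain X where "X \<in> I" using ne by blast
      then obtain Y where "Y \<in> I" "Suc (card Y) = card (Bs ! k)" using * by blast
      then show "int (card (Bs ! k)) - 2 \<in> face_dim ` I" by (auto simp: face_dim_def intro!: image_eqI[of _ _ Y])
    qed
    then show ?L using fd by (simp add: sc_pure_def)
  }
qed

text \<open>Deleting the smaller facets from a shelling leaves a shelling of the triangles: an
  earlier facet that shares two vertices with a triangle is itself a triangle, because a facet with
  only two vertices would be contained in that triangle.\<close>

lemma shellable_imp_tshell:
  assumes "shellable H" "finite V" "H \<subseteq> Pow V" and le3: "\<And>X. X \<in> H \<Longrightarrow> card X \<le> 3"
    and ext: "\<And>X. X \<in> H \<Longrightarrow> \<exists>Y\<in>facets H. X \<subseteq> Y"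
  shows "tshell {X \<in> H. card X = 3}"
proof -
  from assms(1) obtain Bs where Bs: "distinct Bs" "set Bs = facets H"
    and sh: "\<And>k. 1 \<le> k \<Longrightarrow> k < length Bs \<Longrightarrow> card (Bs ! k) \<ge> 2 \<Longrightarrow>
           (let I = (\<Union>i<k. Pow (Bs ! i)) \<inter> Pow (Bs ! k)
            in sc_pure I \<and> sc_dim I = int (card (Bs ! k)) - 2)"
    unfolding shellable_def by blast
  have inH: "Bs ! k \<in> facets H" "Bs ! k \<in> H" "finite (Bs ! k)" if "k < length Bs" for k
    using that Bs(2) assms(2,3) nth_mem[OF that] by (auto simp: facets_def dest: subsetD intro: finite_subset[OF _ assms(2)])
  have "k \<le> length Bs \<Longrightarrow> tshell {X. \<exists>i<k. X = Bs ! i \<and> card X = 3}" for k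
  proof (induction k)
    case 0
    then show ?case by (simp add: tshell.empty)
  next
    case (Suc k)
    let ?S = "{X. \<exists>i<k. X = Bs ! i \<and> card X = 3}"
    have IH: "tshell ?S" and k: "k < length Bs" using Suc by auto
    show ?case
    proof (cases "card (Bs ! k) = 3")
      case False
      then have "{X. \<exists>i<Suc k. X = Bs ! i \<and> card X = 3} = ?S" by (auto simp: less_Suc_eq)
      then show ?thesis using IH by simp
    next
      case True
      then have eq: "{X. \<exists>i<Suc k. X = Bs ! i \<and> card X = 3} = insert (Bs ! k) ?S"
        by (auto simp: less_Suc_eq)
      show ?thesis unfolding eq
      proof (rule tshell.insert[OF IH _ True])
        show "Bs ! k \<notin> ?S" using Bs(1) k by (auto simp: nth_eq_iff_index_eq)
        fix A assume "A \<in> ?S"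
        then obtain i where i: "i < k" "A = Bs ! i" by blast
        have "\<forall>i<k. \<exists>l<k. Bs ! i \<inter> Bs ! k \<subseteq> Bs ! l \<and> Suc (card (Bs ! l \<inter> Bs ! k)) = card (Bs ! k)"
          using sh[of k] face_pure_boundary_iff[OF _ inH(3)[OF k] _ refl] i True k by (simp add: Let_def)
        then obtain l where l: "l < k" "A \<inter> Bs ! k \<subseteq> Bs ! l" "card (Bs ! l \<inter> Bs ! k) = 2"
          using i True by auto
        have lk: "l < length Bs" using l k by simp
        have "card (Bs ! l) = 3"
        proof (rule ccontr)
          assume "card (Bs ! l) \<noteq> 3"
          then have "card (Bs ! l) \<le> 2" using le3[OF inH(2)[OF lk]] by simp
          then have "Bs ! l \<inter> Bs ! k = Bs ! l"
            using l(3) by (intro card_seteq inH lk) auto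
          then have "Bs ! l = Bs ! k" using inH(1)[OF lk] inH(2)[OF k] by (auto simp: facets_def)
          then show False using l True by simp
        qed
        then show "\<exists>B\<in>?S. A \<inter> Bs ! k \<subseteq> B \<and> card (B \<inter> Bs ! k) = 2" using l by blast
      qed
    qed
  qed
  from this[of "length Bs"] have t: "tshell {X. \<exists>i<length Bs. X = Bs ! i \<and> card X = 3}" by simp
  have "{X. \<exists>i<length Bs. X = Bs ! i \<and> card X = 3} = {X \<in> H. card X = 3}" (is "?A = ?B")
  proof
    show "?A \<subseteq> ?B" using inH by auto
    show "?B \<subseteq> ?A"
    proof
      fix X assume X: "X \<in> ?B"
      then obtain Y where Y: "Y \<in> facets H" "X \<subseteq> Y" using ext by blast
      then have "Y \<in> H" by (simp add: facets_def)
      then have "finite Y" "card Y \<le> 3" using le3 assms(2,3) by (auto intro: finite_subset)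
      then have "X = Y" using X Y by (intro card_seteq) auto
      then have "X \<in> set Bs" using Y Bs by simp
      then show "X \<in> ?A" using X by (auto simp: in_set_conv_nth)
    qed
  qed
  then show ?thesis using t by simp
qed

text \<open>The triangles come first and the remaining facets, all edges, follow in any order. Such
  an edge meets every earlier facet in at most one vertex, and it meets some triangle in exactly
  one.\<close>

lemma tshell_imp_shellable:
  assumes t: "tshell {X \<in> H. card X = 3}" and "finite V" "H \<subseteq> Pow V" and le3: "\<And>X. X \<in> H \<Longrightarrow> card X \<le> 3"
    and cov: "\<And>X v. X \<in> facets H \<Longrightarrow> v \<in> X \<Longrightarrow> \<exists>T\<in>H. card T = 3 \<and> v \<in> T"
    and ge2: "\<And>X. X \<in> facets H \<Longrightarrow> card X \<ge> 2"
  shows "shellable H"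
proof -
  let ?D = "{X \<in> H. card X = 3}"
  have fin: "finite X" if "X \<in> H" for X using that assms by (auto intro: finite_subset)
  have "finite H" using assms by (auto intro: finite_subset)
  then have finF: "finite (facets H)" by (simp add: facets_def)
  have D: "?D \<subseteq> facets H"
  proof
    fix X assume X: "X \<in> ?D"
    { fix Y assume "Y \<in> H" "X \<subseteq> Y"
      then have "X = Y" using X le3[of Y] fin[of Y] by (intro card_seteq) auto }
    then show "X \<in> facets H" using X by (auto simp: facets_def)
  qed
  obtain Ts where Ts: "set Ts = ?D" "shelling_list Ts" using tshell_imp_shelling_list[OF t] by blast
  have "\<exists>Bs. set Bs = ?D \<union> E \<and> shelling_list Bs" if "finite E" "E \<subseteq> facets H - ?D" for E
    using that
  proof (induction E rule: finite_induct)
    case empty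
    then show ?case using Ts by auto
  next
    case (insert X E)
    then obtain Bs where Bs: "set Bs = ?D \<union> E" "shelling_list Bs" by auto
    have X: "X \<in> facets H" "X \<notin> ?D" using insert by auto
    then have XH: "X \<in> H" by (simp add: facets_def)
    have c2: "card X = 2" using ge2[OF X(1)] le3[OF XH] X(2) XH by auto
    have "shelling_list (Bs @ [X])"
    proof (rule shelling_list_snoc[OF Bs(2)])
      show "X \<notin> set Bs" using Bs X insert by auto
      fix A assume A: "A \<in> set Bs"
      have proper: "B \<inter> X \<noteq> X" if "B \<in> set Bs" for B
      proof
        assume "B \<inter> X = X"
        then have "X \<subseteq> B" by auto
        moreover have "B \<in> H" using that Bs insert by (auto simp: facets_def)
        ultimately have "X = B" using X by (auto simp: facets_def)
        then show False using that Bs X insert by auto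
      qed
      have less: "card (B \<inter> X) \<le> 1" if "B \<in> set Bs" for B
      proof -
        have "card (B \<inter> X) < card X" using proper[OF that] fin[OF XH] by (intro psubset_card_mono) auto
        then show ?thesis using c2 by simp
      qed
      show "\<exists>B\<in>set Bs. A \<inter> X \<subseteq> B \<and> Suc (card (B \<inter> X)) = card X"
      proof (cases "A \<inter> X = {}")
        case False
        then have "card (A \<inter> X) > 0" using fin[OF XH] by (simp add: card_gt_0_iff)
        then show ?thesis using A less[OF A] c2 by (intro bexI[of _ A]) auto
      next
        case True
        \<comment> \<open>An empty intersection is not of codimension one in an edge; a triangle
          through a vertex of the edge takes over the role of \<open>A\<close>.\<close>
        obtain v where v: "v \<in> X" using c2 by fastforce
        obtain T where T: "T \<in> H" "card T = 3" "v \<in> T" using cov[OF X(1) v] by blast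
        then have TB: "T \<in> set Bs" using Bs by simp
        have "card (T \<inter> X) > 0" using fin[OF XH] v T by (auto simp: card_gt_0_iff)
        then show ?thesis using True TB less[OF TB] c2 by (intro bexI[of _ T]) auto
      qed
    qed
    then show ?case using Bs by (intro exI[of _ "Bs @ [X]"]) simp
  qed
  from this[of "facets H - ?D"] obtain Bs where Bs: "set Bs = facets H" "shelling_list Bs"
    using finF D by (auto simp: Un_absorb1)
  have "(let I = (\<Union>i<k. Pow (Bs ! i)) \<inter> Pow (Bs ! k)
            in sc_pure I \<and> sc_dim I = int (card (Bs ! k)) - 2)"
    if k: "1 \<le> k" "k < length Bs" "card (Bs ! k) \<ge> 2" for k
  proof -
    have "Bs ! k \<in> facets H" using k Bs(1) nth_mem by blast
    then have "finite (Bs ! k)" using fin by (auto simp: facets_def)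
    then show ?thesis using face_pure_boundary_iff[OF k(1) _ k(3) refl] Bs(2) k
      by (simp add: Let_def shelling_list_def)
  qed
  then show ?thesis unfolding shellable_def using Bs by (auto simp: shelling_list_def)
qed

text \<open>The triangles at \<open>v\<close> are cones over the edges \<open>E\<close> of its link.
  They are added in an order in which each edge after the first touches an earlier one, so that a
  new cone shares an edge through \<open>v\<close> with an earlier cone. Old triangles meet the cone
  over \<open>e\<close> within \<open>e\<close>, and \<open>old\<close> makes all of
  \<open>e\<close> part of the intersection.\<close>

lemma tshell_add_vertex:
  fixes D :: "'a set set"
  assumes t: "tshell {T \<in> D. T \<subseteq> W}" and c3: "\<And>T. T \<in> D \<Longrightarrow> card T = 3" and fin: "finite W" and v: "v \<notin> W"
    and E: "E = {e. e \<subseteq> W \<and> insert v e \<in> D}"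
    and conn: "\<And>E'. E' \<subseteq> E \<Longrightarrow> E' \<noteq> {} \<Longrightarrow> E' \<noteq> E \<Longrightarrow> \<exists>e\<in>E - E'. \<exists>e'\<in>E'. e \<inter> e' \<noteq> {}"
    and old: "\<And>e. e \<in> E \<Longrightarrow> \<exists>T\<in>D. T \<subseteq> W \<and> e \<subseteq> T"
  shows "tshell {T \<in> D. T \<subseteq> insert v W}"
proof -
  have "finite E" using fin unfolding E by (auto intro: finite_subset[of _ "Pow W"])
  \<comment> \<open>\<open>P E'\<close> says that the cones over \<open>E'\<close> can be appended
    to the old shelling; a maximal such set is shown to be all of \<open>E\<close>.\<close>
  define P where "P E' \<longleftrightarrow> E' \<subseteq> E \<and> tshell ({T \<in> D. T \<subseteq> W} \<union> insert v ` E')" for E'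
  have "P {}" using t by (simp add: P_def)
  moreover have "finite {E'. P E'}" using \<open>finite E\<close> unfolding P_def by (auto intro: finite_subset[of _ "Pow E"])
  ultimately obtain M where M: "P M" and mx: "\<And>N. P N \<Longrightarrow> M \<subseteq> N \<Longrightarrow> M = N"
    using finite_has_maximal2[of "{E'. P E'}" "{}"] by auto
  let ?S = "{T \<in> D. T \<subseteq> W} \<union> insert v ` M"
  have "M = E"
  proof (rule ccontr)
    assume ne: "M \<noteq> E"
    have ME: "M \<subseteq> E" using M by (simp add: P_def)
    obtain e where e: "e \<in> E" "e \<notin> M" and touch: "M = {} \<or> (\<exists>e'\<in>M. e \<inter> e' \<noteq> {})"
      using conn[OF ME _ ne] ne ME by (cases "M = {}") auto
    let ?T = "insert v e"
    have props: "e' \<subseteq> W" "v \<notin> e'" "card e' = 2" "finite e'" if "e' \<in> E" for e'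
    proof -
      show "e' \<subseteq> W" using that E by blast
      then show "v \<notin> e'" "finite e'" using v fin by (auto intro: finite_subset)
      then show "card e' = 2" using c3[of "insert v e'"] that E by simp
    qed
    have "tshell (insert ?T ?S)"
    proof (rule tshell.insert)
      show "tshell ?S" using M by (simp add: P_def)
      show "?T \<notin> ?S"
      proof
        assume "?T \<in> ?S"
        then consider "?T \<subseteq> W" | e' where "e' \<in> M" "insert v e = insert v e'" by blast
        then show False
        proof cases
          case 2
          then have "e = e'" using props(2)[OF e(1)] props(2)[of e'] ME insert_ident[of v e e'] by blast
          then show False using 2 e by simp
        qed (use v in blast)
      qed
      show "card ?T = 3" using e E c3 by blast
      fix A assume "A \<in> ?S"
      then consider "A \<in> D" "A \<subseteq> W" | e' where "e' \<in> M" "A = insert v e'" by blast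
      then show "\<exists>B\<in>?S. A \<inter> ?T \<subseteq> B \<and> card (B \<inter> ?T) = 2"
      proof cases
        case 1
        obtain B where B: "B \<in> D" "B \<subseteq> W" "e \<subseteq> B" using old[OF e(1)] by blast
        then have "B \<inter> ?T = e" "A \<inter> ?T \<subseteq> e" using v 1 by auto
        then show ?thesis using B props[OF e(1)] by (intro bexI[of _ B]) auto
      next
        case 2
        \<comment> \<open>Two distinct edges that meet share exactly one vertex, so their cones
          share the edge from that vertex to \<open>v\<close>.\<close>
        have meet: "card (insert v e'' \<inter> ?T) = 2" if e'': "e'' \<in> M" "e \<inter> e'' \<noteq> {}" for e''
        proof -
          have pe: "e'' \<subseteq> W" "v \<notin> e''" "card e'' = 2" "finite e''" using props[of e''] e'' ME by auto
          have "e \<inter> e'' \<noteq> e"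
            using card_seteq[of e'' e] pe props[OF e(1)] e(2) e''(1) by auto
          then have "card (e \<inter> e'') < 2" using psubset_card_mono[of e "e \<inter> e''"] props[OF e(1)] by auto
          moreover have "card (e \<inter> e'') > 0" using e'' pe by (simp add: card_gt_0_iff)
          ultimately have "card (e'' \<inter> e) = 1" by (simp add: Int_commute)
          moreover have "insert v e'' \<inter> ?T = insert v (e'' \<inter> e)" by auto
          ultimately show ?thesis using pe by simp
        qed
        show ?thesis
        proof (cases "e \<inter> e' = {}")
          case True
          \<comment> \<open>The cones over disjoint edges meet only in \<open>v\<close>, which lies
            in the edge shared with the cone over a touching edge.\<close>
          obtain e'' where e'': "e'' \<in> M" "e \<inter> e'' \<noteq> {}" using touch 2 by blast
          have "A \<inter> ?T \<subseteq> {v}" using 2 True by auto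
          then show ?thesis using meet[OF e''] e'' by (intro bexI[of _ "insert v e''"]) auto
        next
          case False
          then show ?thesis using meet[OF 2(1)] 2 by (intro bexI[of _ A]) auto
        qed
      qed
    qed
    then have "P (insert e M)" using e ME by (simp add: P_def)
    then show False using mx e by blast
  qed
  moreover have "{T \<in> D. T \<subseteq> W} \<union> insert v ` E = {T \<in> D. T \<subseteq> insert v W}" (is "?L = ?R")
  proof
    show "?L \<subseteq> ?R" using E by auto
    show "?R \<subseteq> ?L"
    proof
      fix T assume T: "T \<in> ?R"
      show "T \<in> ?L"
      proof (cases "v \<in> T")
        case True
        then have "T = insert v (T - {v})" by blast
        then have "T - {v} \<in> E" using T E by (auto simp: insert_absorb)
        then show ?thesis using \<open>T = insert v (T - {v})\<close> by blast
      qed (use T in auto)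
    qed
  qed
  ultimately show ?thesis using M by (simp add: P_def)
qed

section \<open>Reduced homology in low degrees\<close>

lemma simplicial_chainsD:
  assumes "c \<in> simplicial_chains K k"
  shows "c xs \<noteq> 0 \<Longrightarrow> distinct xs \<and> set xs \<in> K \<and> face_dim (set xs) = k"
    and "c (xs @ x # y # ys) = - c (xs @ y # x # ys)"
  using assms unfolding simplicial_chains_def by blast+

lemma simplicial_chainsI:
  assumes "\<And>xs. c xs \<noteq> 0 \<Longrightarrow> distinct xs \<and> set xs \<in> K \<and> face_dim (set xs) = k"
    and "\<And>xs x y ys. c (xs @ x # y # ys) = - c (xs @ y # x # ys)"
  shows "c \<in> simplicial_chains K k"
  using assms unfolding simplicial_chains_def by blast

lemma zero_chain: "(\<lambda>xs. 0) \<in> simplicial_chains K k"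
  by (rule simplicial_chainsI) auto

lemma add_chain:
  assumes "c \<in> simplicial_chains K k" "d \<in> simplicial_chains K k"
  shows "(\<lambda>xs. c xs + d xs) \<in> simplicial_chains K k"
proof (rule simplicial_chainsI)
  fix xs assume "c xs + d xs \<noteq> 0"
  then have "c xs \<noteq> 0 \<or> d xs \<noteq> 0" by auto
  then show "distinct xs \<and> set xs \<in> K \<and> face_dim (set xs) = k" using simplicial_chainsD assms by metis
next
  fix xs x y ys
  show "c (xs @ x # y # ys) + d (xs @ x # y # ys) = - (c (xs @ y # x # ys) + d (xs @ y # x # ys))"
    using simplicial_chainsD(2)[OF assms(1), of xs x y ys] simplicial_chainsD(2)[OF assms(2), of xs x y ys] by simp
qed

lemma scale_chain:
  assumes "c \<in> simplicial_chains K k"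
  shows "(\<lambda>xs. a * c xs) \<in> simplicial_chains K k"
proof (rule simplicial_chainsI)
  fix xs assume "a * c xs \<noteq> 0"
  then show "distinct xs \<and> set xs \<in> K \<and> face_dim (set xs) = k" using simplicial_chainsD(1)[OF assms] by simp
next
  fix xs x y ys
  show "a * c (xs @ x # y # ys) = - (a * c (xs @ y # x # ys))"
    using simplicial_chainsD(2)[OF assms, of xs x y ys] by simp
qed

lemma chains_mono: "K \<subseteq> L \<Longrightarrow> simplicial_chains K k \<subseteq> simplicial_chains L k"
  unfolding simplicial_chains_def by blast

lemma boundary_add: "simplicial_boundary K (\<lambda>xs. c xs + d xs) = (\<lambda>xs. simplicial_boundary K c xs + simplicial_boundary K d xs)"
  by (simp add: simplicial_boundary_def sum.distrib)

lemma boundary_scale: "simplicial_boundary K (\<lambda>xs. a * c xs) = (\<lambda>xs. a * simplicial_boundary K c xs)"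
  by (simp add: simplicial_boundary_def sum_distrib_left)

lemma boundary_zero: "simplicial_boundary K (\<lambda>xs. 0) = (\<lambda>xs. 0)"
  by (simp add: simplicial_boundary_def)

lemma boundary_chain:
  assumes down: "\<And>X Y. X \<in> K \<Longrightarrow> Y \<subseteq> X \<Longrightarrow> Y \<in> K" and c: "c \<in> simplicial_chains K (k + 1)"
  shows "simplicial_boundary K c \<in> simplicial_chains K k"
proof (rule simplicial_chainsI)
  fix xs assume "simplicial_boundary K c xs \<noteq> 0"
  then obtain v where "c (v # xs) \<noteq> 0" unfolding simplicial_boundary_def by (meson sum.neutral)
  then have "distinct (v # xs)" "set (v # xs) \<in> K" "face_dim (set (v # xs)) = k + 1"
    using simplicial_chainsD(1)[OF c] by blast+
  then show "distinct xs \<and> set xs \<in> K \<and> face_dim (set xs) = k"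
    using down[of "set (v # xs)" "set xs"] by (auto simp: face_dim_def)
next
  fix xs x y ys
  show "simplicial_boundary K c (xs @ x # y # ys) = - simplicial_boundary K c (xs @ y # x # ys)"
    using simplicial_chainsD(2)[OF c, of "_ # xs" x y ys] by (simp add: simplicial_boundary_def sum_negf)
qed

text \<open>Exchanging the two added vertices changes the sign of every summand but only permutes
  the double sum, so the sum equals its own negative.\<close>

lemma boundary_boundary:
  assumes "c \<in> simplicial_chains K k"
  shows "simplicial_boundary K (simplicial_boundary K c) = (\<lambda>xs. 0)"
proof
  fix xs
  let ?S = "\<Sum>v\<in>\<Union>K. \<Sum>w\<in>\<Union>K. c (w # v # xs)"
  have "c (w # v # xs) = - c (v # w # xs)" for v w
    using simplicial_chainsD(2)[OF assms, of "[]" w v xs] by simp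
  then have "?S = (\<Sum>v\<in>\<Union>K. \<Sum>w\<in>\<Union>K. - c (v # w # xs))" by (intro sum.cong refl)
  also have "\<dots> = - (\<Sum>v\<in>\<Union>K. \<Sum>w\<in>\<Union>K. c (v # w # xs))" by (simp add: sum_negf)
  also have "(\<Sum>v\<in>\<Union>K. \<Sum>w\<in>\<Union>K. c (v # w # xs)) = ?S" by (rule sum.swap)
  finally have "?S = 0" by simp
  then show "simplicial_boundary K (simplicial_boundary K c) xs = 0" by (simp add: simplicial_boundary_def)
qed

lemma cycles_iff:
  "c \<in> simplicial_cycles K k \<longleftrightarrow> c \<in> simplicial_chains K k \<and> (\<forall>xs. simplicial_boundary K c xs = 0)"
  unfolding simplicial_cycles_def kernel_def simplicial_chain_group_def by (auto simp: fun_eq_iff)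

text \<open>The cycles form an abelian group with the boundaries as a subgroup, and the quotient is
  trivial iff every coset of the boundaries is the subgroup itself. Closure of \<open>K\<close>
  under subsets ensures that the boundary of a chain is again a chain on \<open>K\<close>.\<close>

lemma trivial_reduced_homology_iff:
  assumes down: "\<And>X Y. X \<in> K \<Longrightarrow> Y \<subseteq> X \<Longrightarrow> Y \<in> K"
  shows "trivial_group (reduced_homology K k) \<longleftrightarrow> simplicial_cycles K k \<subseteq> simplicial_boundaries K k"
proof -
  define G where "G = (simplicial_chain_group K k)\<lparr>carrier := simplicial_cycles K k\<rparr>"
  let ?B = "simplicial_boundaries K k"
  have carrier_G: "carrier G = simplicial_cycles K k" and mult_G: "\<And>c d. c \<otimes>\<^bsub>G\<^esub> d = (\<lambda>xs. c xs + d xs)"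
    and one_G: "\<one>\<^bsub>G\<^esub> = (\<lambda>xs. 0)"
    by (simp_all add: G_def simplicial_chain_group_def)
  have cyc_add: "(\<lambda>xs. c xs + d xs) \<in> simplicial_cycles K k" if "c \<in> simplicial_cycles K k" "d \<in> simplicial_cycles K k" for c d
    using that by (auto simp: cycles_iff add_chain boundary_add)
  have cyc_neg: "(\<lambda>xs. - c xs) \<in> simplicial_cycles K k" if "c \<in> simplicial_cycles K k" for c
    using that scale_chain[of c K k "-1"] boundary_scale[of K "-1" c] by (auto simp: cycles_iff)
  have cyc_zero: "(\<lambda>xs. 0) \<in> simplicial_cycles K k" by (simp add: cycles_iff zero_chain boundary_zero)
  have cg: "comm_group G"
  proof (rule comm_groupI)
    show "\<exists>y\<in>carrier G. y \<otimes>\<^bsub>G\<^esub> x = \<one>\<^bsub>G\<^esub>" if "x \<in> carrier G" for x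
      using that cyc_neg by (intro bexI[of _ "\<lambda>xs. - x xs"]) (auto simp: carrier_G mult_G one_G)
  qed (auto simp: carrier_G mult_G one_G cyc_add cyc_zero add.assoc add.commute)
  interpret G: comm_group G by (rule cg)
  have BC: "?B \<subseteq> carrier G"
  proof
    fix c assume "c \<in> ?B"
    then obtain d where d: "d \<in> simplicial_chains K (k + 1)" "c = simplicial_boundary K d"
      unfolding simplicial_boundaries_def by blast
    have "simplicial_boundary K d \<in> simplicial_chains K k" by (rule boundary_chain[OF down d(1)])
    then show "c \<in> carrier G" using boundary_boundary[OF d(1)] by (simp add: carrier_G cycles_iff d(2))
  qed
  have inv_G: "inv\<^bsub>G\<^esub> c = (\<lambda>xs. - c xs)" if "c \<in> carrier G" for c
    using that cyc_neg by (intro G.inv_equality) (auto simp: carrier_G mult_G one_G)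
  have sub: "subgroup ?B G"
  proof (rule G.subgroupI[OF BC])
    show "?B \<noteq> {}" using zero_chain unfolding simplicial_boundaries_def by blast
    show "inv\<^bsub>G\<^esub> c \<in> ?B" if "c \<in> ?B" for c
    proof -
      from that obtain d where d: "d \<in> simplicial_chains K (k + 1)" "c = simplicial_boundary K d"
        unfolding simplicial_boundaries_def by blast
      then have "(\<lambda>xs. - c xs) = simplicial_boundary K (\<lambda>xs. -1 * d xs)" by (simp only: boundary_scale) simp
      moreover have "(\<lambda>xs. -1 * d xs) \<in> simplicial_chains K (k + 1)" using d(1) by (rule scale_chain)
      ultimately have "(\<lambda>xs. - c xs) \<in> ?B" unfolding simplicial_boundaries_def by blast
      then show ?thesis using inv_G[of c] that BC by auto
    qed
    show "c \<otimes>\<^bsub>G\<^esub> d \<in> ?B" if "c \<in> ?B" "d \<in> ?B" for c d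
    proof -
      from that obtain c' d' where d: "c' \<in> simplicial_chains K (k + 1)" "c = simplicial_boundary K c'"
        "d' \<in> simplicial_chains K (k + 1)" "d = simplicial_boundary K d'"
        unfolding simplicial_boundaries_def by blast
      then have "c \<otimes>\<^bsub>G\<^esub> d = simplicial_boundary K (\<lambda>xs. c' xs + d' xs)" by (simp add: mult_G boundary_add)
      then show ?thesis using add_chain[OF d(1,3)] unfolding simplicial_boundaries_def by blast
    qed
  qed
  then have normal: "?B \<lhd> G" by (rule G.subgroup_imp_normal)
  have "trivial_group (reduced_homology K k) \<longleftrightarrow> carrier (G Mod ?B) = {?B}"
    unfolding reduced_homology_def G_def[symmetric] trivial_group_def
    using normal.factorgroup_is_group[OF normal] by simp
  also have "\<dots> \<longleftrightarrow> carrier G \<subseteq> ?B"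
  proof
    assume *: "carrier (G Mod ?B) = {?B}"
    show "carrier G \<subseteq> ?B"
    proof
      fix x assume x: "x \<in> carrier G"
      then have "?B #>\<^bsub>G\<^esub> x = ?B" using * by (auto simp: carrier_FactGroup)
      then show "x \<in> ?B" using G.rcos_self[OF x sub] by simp
    qed
  next
    assume "carrier G \<subseteq> ?B"
    then have "?B #>\<^bsub>G\<^esub> x = ?B" if "x \<in> carrier G" for x
      using that G.coset_join2[OF that sub] by blast
    moreover have "\<one>\<^bsub>G\<^esub> \<in> carrier G" by simp
    ultimately show "carrier (G Mod ?B) = {?B}" unfolding carrier_FactGroup by blast
  qed
  finally show ?thesis by (simp add: carrier_G)
qed

lemma boundariesI: "d \<in> simplicial_chains K (k + 1) \<Longrightarrow> c = simplicial_boundary K d \<Longrightarrow> c \<in> simplicial_boundaries K k"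
  unfolding simplicial_boundaries_def by blast

lemma boundaries_zero: "(\<lambda>xs. 0) \<in> simplicial_boundaries K k"
  by (rule boundariesI[OF zero_chain]) (simp add: boundary_zero)

lemma boundaries_add:
  assumes "c \<in> simplicial_boundaries K k" "d \<in> simplicial_boundaries K k"
  shows "(\<lambda>xs. c xs + d xs) \<in> simplicial_boundaries K k"
proof -
  obtain c' d' where "c' \<in> simplicial_chains K (k + 1)" "c = simplicial_boundary K c'"
    "d' \<in> simplicial_chains K (k + 1)" "d = simplicial_boundary K d'"
    using assms unfolding simplicial_boundaries_def by blast
  then show ?thesis by (intro boundariesI[OF add_chain[of c' K _ d']]) (simp_all add: boundary_add)
qed

lemma boundaries_scale:
  assumes "c \<in> simplicial_boundaries K k"
  shows "(\<lambda>xs. a * c xs) \<in> simplicial_boundaries K k"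
proof -
  obtain c' where "c' \<in> simplicial_chains K (k + 1)" "c = simplicial_boundary K c'"
    using assms unfolding simplicial_boundaries_def by blast
  then show ?thesis by (intro boundariesI[OF scale_chain[of c']]) (simp_all add: boundary_scale)
qed

lemma boundaries_sum:
  "finite A \<Longrightarrow> (\<And>v. v \<in> A \<Longrightarrow> f v \<in> simplicial_boundaries K k) \<Longrightarrow> (\<lambda>xs. \<Sum>v\<in>A. f v xs) \<in> simplicial_boundaries K k"
proof (induction A rule: finite_induct)
  case empty
  then show ?case by (simp add: boundaries_zero)
next
  case (insert v A)
  then show ?case using boundaries_add[of "f v" K k "\<lambda>xs. \<Sum>v\<in>A. f v xs"] by simp
qed

lemma cycles_subset_boundaries_no_face:
  assumes "\<And>X. X \<in> K \<Longrightarrow> face_dim X \<noteq> k"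
  shows "simplicial_cycles K k \<subseteq> simplicial_boundaries K k"
proof
  fix c assume "c \<in> simplicial_cycles K k"
  then have "c \<in> simplicial_chains K k" by (simp add: cycles_iff)
  then have "c = (\<lambda>xs. 0)" using simplicial_chainsD(1)[of c K k] assms by blast
  then show "c \<in> simplicial_boundaries K k" by (simp add: boundaries_zero)
qed

section \<open>Elementary chains and their boundaries\<close>

definition point_chain :: "'a \<Rightarrow> 'a list \<Rightarrow> int" where
  "point_chain p xs = (if xs = [p] then 1 else 0)"

definition edge_chain :: "'a \<Rightarrow> 'a \<Rightarrow> 'a list \<Rightarrow> int" where
  "edge_chain p q xs = (if xs = [p, q] then 1 else if xs = [q, p] then - 1 else 0)"

text \<open>The elementary chain of the oriented triangle \<open>[x, y, z]\<close>, expanded along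
  the first entry of the list: what remains is the opposite edge, oriented cyclically. Summing over
  the first entry then yields the boundary at once.\<close>

definition triangle_chain :: "'a \<Rightarrow> 'a \<Rightarrow> 'a \<Rightarrow> 'a list \<Rightarrow> int" where
  "triangle_chain x y z xs = (case xs of [] \<Rightarrow> 0 | v # ws \<Rightarrow>
     (if v = x then edge_chain y z ws else 0) + (if v = y then edge_chain z x ws else 0) +
     (if v = z then edge_chain x y ws else 0))"

lemma point_chain_in_chains: "{p} \<in> K \<Longrightarrow> point_chain p \<in> simplicial_chains K 0"
  by (rule simplicial_chainsI) (auto simp: point_chain_def face_dim_def split: if_splits)

lemma edge_chain_in_chains:
  assumes "{p, q} \<in> K" "p \<noteq> q"
  shows "edge_chain p q \<in> simplicial_chains K 1"
proof (rule simplicial_chainsI)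
  show "distinct xs \<and> set xs \<in> K \<and> face_dim (set xs) = 1" if "edge_chain p q xs \<noteq> 0" for xs
    using that assms by (auto simp: edge_chain_def face_dim_def insert_commute split: if_splits)
  show "edge_chain p q (xs @ x # y # ys) = - edge_chain p q (xs @ y # x # ys)" for xs x y ys
    using assms(2) by (cases xs) (auto simp: edge_chain_def)
qed

lemma triangle_chain_in_chains:
  assumes "{x, y, z} \<in> K" "x \<noteq> y" "x \<noteq> z" "y \<noteq> z"
  shows "triangle_chain x y z \<in> simplicial_chains K 2"
proof (rule simplicial_chainsI)
  have perms: "{x, z, y} \<in> K" "{y, x, z} \<in> K" "{y, z, x} \<in> K" "{z, x, y} \<in> K" "{z, y, x} \<in> K"
    using assms(1) by (simp_all add: insert_commute)
  show "distinct xs \<and> set xs \<in> K \<and> face_dim (set xs) = 2" if "triangle_chain x y z xs \<noteq> 0" for xs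
    using that assms perms
    by (auto simp: triangle_chain_def edge_chain_def face_dim_def split: if_splits list.splits)
  show "triangle_chain x y z (xs @ a # b # ys) = - triangle_chain x y z (xs @ b # a # ys)" for xs a b ys
  proof (cases xs)
    case Nil
    then show ?thesis using assms by (auto simp: triangle_chain_def edge_chain_def)
  next
    case (Cons u us)
    have "edge_chain p q (us @ a # b # ys) = - edge_chain p q (us @ b # a # ys)" if "p \<noteq> q" for p q
      using that by (cases us) (auto simp: edge_chain_def)
    then show ?thesis using Cons assms by (simp add: triangle_chain_def)
  qed
qed

lemma edge_chain_boundary:
  assumes "finite U" "p \<in> U" "q \<in> U" "p \<noteq> q"
  shows "(\<Sum>v\<in>U. edge_chain p q (v # xs)) = point_chain q xs - point_chain p xs"
proof -
  have "edge_chain p q (v # xs) = (if v = p then point_chain q xs else 0) - (if v = q then point_chain p xs else 0)" for v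
    using assms(4) by (auto simp: edge_chain_def point_chain_def)
  then show ?thesis using assms by (simp add: sum_subtractf)
qed

lemma triangle_chain_boundary:
  assumes "finite U" "x \<in> U" "y \<in> U" "z \<in> U"
  shows "(\<Sum>v\<in>U. triangle_chain x y z (v # xs)) = edge_chain x y xs + edge_chain y z xs + edge_chain z x xs"
  using assms by (simp add: triangle_chain_def sum.distrib)

text \<open>A chain in degree -1 is a single integer, the value at the empty list, and that multiple
  of any vertex has it as its augmentation.\<close>

lemma cycles_subset_boundaries_minus_one:
  assumes down: "\<And>X Y. X \<in> K \<Longrightarrow> Y \<subseteq> X \<Longrightarrow> Y \<in> K" and fin: "finite (\<Union>K)" and v: "v \<in> \<Union>K"
  shows "simplicial_cycles K (- 1) \<subseteq> simplicial_boundaries K (- 1)"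
proof
  fix c assume "c \<in> simplicial_cycles K (- 1)"
  then have c: "c \<in> simplicial_chains K (- 1)" by (simp add: cycles_iff)
  have c0: "c xs = 0" if "xs \<noteq> []" for xs
    using simplicial_chainsD(1)[OF c, of xs] that by (auto simp: face_dim_def)
  have "{v} \<in> K" using v down by blast
  then have "(\<lambda>xs. c [] * point_chain v xs) \<in> simplicial_chains K (- 1 + 1)"
    using scale_chain[OF point_chain_in_chains] by simp
  moreover have "c = simplicial_boundary K (\<lambda>xs. c [] * point_chain v xs)"
  proof
    fix xs
    have "(\<Sum>w\<in>\<Union>K. c [] * point_chain v (w # xs)) = (\<Sum>w\<in>\<Union>K. if w = v then c xs else 0)"
      by (rule sum.cong) (auto simp: point_chain_def c0)
    then show "c xs = simplicial_boundary K (\<lambda>xs. c [] * point_chain v xs) xs"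
      using fin v by (simp add: simplicial_boundary_def)
  qed
  ultimately show "c \<in> simplicial_boundaries K (- 1)" by (rule boundariesI)
qed

text \<open>By connectedness every difference of a vertex and \<open>v0\<close> bounds. The
  coefficients of a 0-cycle add up to zero, so the cycle is the combination of these differences
  with its own coefficients. Connectedness is stated as an induction principle: a set that contains
  \<open>v0\<close> and is closed under edges contains every vertex.\<close>

lemma cycles_subset_boundaries_zero:
  assumes down: "\<And>X Y. X \<in> K \<Longrightarrow> Y \<subseteq> X \<Longrightarrow> Y \<in> K" and fin: "finite (\<Union>K)" and v0: "v0 \<in> \<Union>K"
    and conn: "\<And>X. v0 \<in> X \<Longrightarrow> (\<And>p q. p \<in> X \<Longrightarrow> {p, q} \<in> K \<Longrightarrow> p \<noteq> q \<Longrightarrow> q \<in> X) \<Longrightarrow> \<Union>K \<subseteq> X"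
  shows "simplicial_cycles K 0 \<subseteq> simplicial_boundaries K 0"
proof
  define X where "X = {v. (\<lambda>xs. point_chain v xs - point_chain v0 xs) \<in> simplicial_boundaries K 0}"
  have X: "\<Union>K \<subseteq> X"
  proof (rule conn)
    show "v0 \<in> X" using boundaries_zero by (simp add: X_def)
    fix p q assume pq: "p \<in> X" "{p, q} \<in> K" "p \<noteq> q"
    have "p \<in> \<Union>K" "q \<in> \<Union>K" using pq(2) by blast+
    then have "(\<lambda>xs. point_chain q xs - point_chain p xs) = simplicial_boundary K (edge_chain p q)"
      using edge_chain_boundary[OF fin _ _ pq(3)] by (simp add: simplicial_boundary_def)
    moreover have "edge_chain p q \<in> simplicial_chains K (0 + 1)" using edge_chain_in_chains[OF pq(2,3)] by simp
    ultimately have "(\<lambda>xs. point_chain q xs - point_chain p xs) \<in> simplicial_boundaries K 0"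
      using boundariesI by blast
    then have "(\<lambda>xs. (point_chain q xs - point_chain p xs) + (point_chain p xs - point_chain v0 xs)) \<in> simplicial_boundaries K 0"
      using pq(1) unfolding X_def by (intro boundaries_add) simp_all
    then show "q \<in> X" by (simp add: X_def)
  qed
  fix c assume "c \<in> simplicial_cycles K 0"
  then have c: "c \<in> simplicial_chains K 0" and cyc: "(\<Sum>v\<in>\<Union>K. c [v]) = 0"
    by (auto simp: cycles_iff simplicial_boundary_def)
  have "(\<lambda>xs. \<Sum>v\<in>\<Union>K. c [v] * (point_chain v xs - point_chain v0 xs)) \<in> simplicial_boundaries K 0"
    using X by (intro boundaries_sum[OF fin] boundaries_scale) (auto simp: X_def)
  moreover have "(\<Sum>v\<in>\<Union>K. c [v] * (point_chain v xs - point_chain v0 xs)) = c xs" for xs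
  proof -
    have "(\<Sum>v\<in>\<Union>K. c [v] * (point_chain v xs - point_chain v0 xs))
        = (\<Sum>v\<in>\<Union>K. c [v] * point_chain v xs) - (\<Sum>v\<in>\<Union>K. c [v]) * point_chain v0 xs"
      by (simp add: right_diff_distrib sum_subtractf sum_distrib_right)
    also have "\<dots> = (\<Sum>v\<in>\<Union>K. c [v] * point_chain v xs)" by (simp add: cyc)
    also have "\<dots> = c xs"
    proof (cases "c xs = 0")
      case True
      then show ?thesis by (intro trans[OF sum.neutral]) (auto simp: point_chain_def)
    next
      case False
      then have *: "distinct xs" "set xs \<in> K" "card (set xs) = 1"
        using simplicial_chainsD(1)[OF c, of xs] by (auto simp: face_dim_def)
      then have "length xs = 1" by (simp add: distinct_card)
      then obtain p where p: "xs = [p]" by (auto simp: length_Suc_conv)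
      then have "(\<Sum>v\<in>\<Union>K. c [v] * point_chain v xs) = (\<Sum>v\<in>\<Union>K. if v = p then c xs else 0)"
        by (intro sum.cong) (auto simp: point_chain_def)
      then show ?thesis using fin * p by auto
    qed
    finally show ?thesis .
  qed
  ultimately show "c \<in> simplicial_boundaries K 0" by simp
qed

section \<open>First homology along a shelling and its detection by cocycles\<close>

lemma chain1_list:
  assumes "c \<in> simplicial_chains K 1" "c xs \<noteq> 0"
  obtains p q where "xs = [p, q]" "p \<noteq> q" "{p, q} \<in> K"
proof -
  have *: "distinct xs" "set xs \<in> K" "card (set xs) = 2"
    using simplicial_chainsD(1)[OF assms] by (auto simp: face_dim_def)
  then have "length xs = 2" by (simp add: distinct_card)
  then obtain p q where "xs = [p, q]" by (auto simp: length_Suc_conv numeral_2_eq_2)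
  then show ?thesis using that * by auto
qed

text \<open>Induction along the shelling: a multiple of the boundary of the new triangle is
  subtracted to push the cycle into the old complex. The boundary is summed over a fixed set
  \<open>U\<close>, so that the operator does not change when the vertex set grows.\<close>

lemma tshell_cycle_bounds:
  assumes "tshell S" "finite U" "\<Union>S \<subseteq> U" "c \<in> simplicial_chains {X. \<exists>T\<in>S. X \<subseteq> T} 1"
    "\<And>xs. (\<Sum>v\<in>U. c (v # xs)) = 0"
  shows "\<exists>d\<in>simplicial_chains {X. \<exists>T\<in>S. X \<subseteq> T} 2. c = (\<lambda>xs. \<Sum>v\<in>U. d (v # xs))"
  using assms
proof (induction arbitrary: c rule: tshell.induct)
  case empty
  then have "c \<in> simplicial_chains {} 1" by simp
  then have "c = (\<lambda>xs. 0)" using simplicial_chainsD(1)[of c "{}" 1] by blast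
  then show ?case by (intro bexI[OF _ zero_chain]) simp
next
  case (insert S T)
  define K L where "K = {X. \<exists>T\<in>S. X \<subseteq> T}" and "L = {X. \<exists>A\<in>insert T S. X \<subseteq> A}"
  have KL: "K \<subseteq> L" and L_cases: "\<And>X. X \<in> L \<Longrightarrow> X \<in> K \<or> X \<subseteq> T" and L_T: "\<And>X. X \<subseteq> T \<Longrightarrow> X \<in> L"
    and K_I: "\<And>X A. A \<in> S \<Longrightarrow> X \<subseteq> A \<Longrightarrow> X \<in> K" and K_D: "\<And>X. X \<in> K \<Longrightarrow> X \<subseteq> \<Union>S"
    by (auto simp: K_def L_def)
  have US: "\<Union>S \<subseteq> U" "T \<subseteq> U" using insert.prems by auto
  note c = insert.prems(3)[folded L_def] and IH = insert.IH[folded K_def] and cyc = insert.prems(4)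
  have "\<exists>d\<in>simplicial_chains L 2. c = (\<lambda>xs. \<Sum>v\<in>U. d (v # xs))"
  \<comment> \<open>If all edges of \<open>T\<close> are old, the cycle is already a chain on the
    old complex; otherwise a new edge \<open>{x, y}\<close> is used to correct it.\<close>
  proof (cases "\<exists>x y. x \<in> T \<and> y \<in> T \<and> x \<noteq> y \<and> {x, y} \<notin> K")
    case False
    have "c \<in> simplicial_chains K 1"
    proof (rule simplicial_chainsI)
      fix xs assume xs: "c xs \<noteq> 0"
      then obtain p q where pq: "xs = [p, q]" "p \<noteq> q" "{p, q} \<in> L" by (rule chain1_list[OF c])
      have "{p, q} \<in> K"
      proof (rule ccontr)
        assume n: "{p, q} \<notin> K"
        then have "{p, q} \<subseteq> T" using pq(3) L_cases by blast
        then have "p \<in> T" "q \<in> T" by simp_all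
        then show False using False pq(2) n by blast
      qed
      then show "distinct xs \<and> set xs \<in> K \<and> face_dim (set xs) = 1"
        using pq by (simp add: face_dim_def)
    qed (rule simplicial_chainsD(2)[OF c])
    then obtain d where d: "d \<in> simplicial_chains K 2" "c = (\<lambda>xs. \<Sum>v\<in>U. d (v # xs))"
      using IH[OF insert.prems(1) US(1) _ cyc] by blast
    show ?thesis using d(2) subsetD[OF chains_mono[OF KL] d(1)] by (rule bexI)
  next
    case True
    then obtain x y where xy: "x \<in> T" "y \<in> T" "x \<noteq> y" "{x, y} \<notin> K" by blast
    have "finite T" using insert.hyps(3) by (intro card_ge_0_finite) simp
    then have "card (T - {x, y}) = 1" using xy insert.hyps(3) by (simp add: card_Diff_subset)
    then obtain z where z: "T - {x, y} = {z}" by (auto simp: card_1_singleton_iff)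
    then have T: "T = {x, y, z}" and zne: "x \<noteq> z" "y \<noteq> z" using xy by auto
    let ?t = "triangle_chain x y z"
    have TU: "x \<in> U" "y \<in> U" "z \<in> U" using US T by auto
    have t: "?t \<in> simplicial_chains L 2"
      using T xy zne by (intro triangle_chain_in_chains L_T) auto
    define b where "b = (\<lambda>xs. edge_chain x y xs + edge_chain y z xs + edge_chain z x xs)"
    have tb: "(\<Sum>v\<in>U. ?t (v # xs)) = b xs" for xs
      unfolding b_def by (rule triangle_chain_boundary[OF insert.prems(1) TU])
    have b: "b \<in> simplicial_chains L 1"
      unfolding b_def using T xy zne by (intro add_chain edge_chain_in_chains L_T) auto
    have b0: "(\<Sum>v\<in>U. b (v # xs)) = 0" for xs
      unfolding b_def using TU xy zne insert.prems(1) by (simp add: sum.distrib edge_chain_boundary)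
    \<comment> \<open>The boundary \<open>b\<close> of \<open>T\<close> has coefficient 1 on
      \<open>[x, y]\<close>, so this multiple cancels the new edge.\<close>
    define c' where "c' = (\<lambda>xs. c xs + (- c [x, y]) * b xs)"
    have c': "c' \<in> simplicial_chains L 1"
      unfolding c'_def by (intro add_chain scale_chain c b)
    have cyc': "(\<Sum>v\<in>U. c' (v # xs)) = 0" for xs
      using cyc b0 unfolding c'_def sum.distrib sum_distrib_left[symmetric] by simp
    have "b [x, y] = 1" using xy zne by (simp add: b_def edge_chain_def)
    then have c'xy: "c' [x, y] = 0" by (simp add: c'_def)
    have flip: "c' [q, p] = - c' [p, q]" for p q using simplicial_chainsD(2)[OF c', of "[]" q p "[]"] by simp
    \<comment> \<open>If both edges of \<open>T\<close> at \<open>a\<close> are new, then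
      \<open>a\<close> is a new vertex: an old triangle through \<open>a\<close> would, by the
      shelling condition, yield an old edge of \<open>T\<close> at \<open>a\<close>. So
      \<open>c'\<close> can be nonzero at \<open>a\<close> only on the edges to \<open>b\<close> and
      \<open>w\<close>; the first value vanishes by assumption, and the cycle condition at
      \<open>a\<close> forces the second to vanish.\<close>
    have kill: "c' [w, a] = 0" if T': "T = {a, b, w}" and ab: "{a, b} \<notin> K" "{a, w} \<notin> K" "a \<noteq> b" "a \<noteq> w" "b \<noteq> w"
        and z0: "c' [b, a] = 0" for a b w
    proof -
      have "a \<notin> \<Union>S"
      proof
        assume "a \<in> \<Union>S"
        then obtain A where "A \<in> S" "a \<in> A" by blast
        then obtain B where B: "B \<in> S" "A \<inter> T \<subseteq> B" "card (B \<inter> T) = 2" using insert.hyps(4) by blast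
        then have aB: "a \<in> B \<inter> T" using \<open>a \<in> A\<close> T' by blast
        have "b \<notin> B" "w \<notin> B" using aB ab(1,2) K_I[OF B(1)] by auto
        then have "B \<inter> T = {a}" using aB T' by blast
        then show False using B(3) by simp
      qed
      have "c' [v, a] = 0" if "v \<noteq> w" for v
      proof (rule ccontr)
        assume n: "c' [v, a] \<noteq> 0"
        obtain p q where "[v, a] = [p, q]" "p \<noteq> q" "{p, q} \<in> L" using n by (rule chain1_list[OF c'])
        then have "v \<noteq> a" "{v, a} \<in> L" by simp_all
        then have "v \<in> T" using \<open>a \<notin> \<Union>S\<close> L_cases[of "{v, a}"] K_D[of "{v, a}"] by blast
        then have "v = b" using T' that \<open>v \<noteq> a\<close> by blast
        then show False using n z0 by simp
      qed
      then have "(\<Sum>v\<in>U. c' [v, a]) = (\<Sum>v\<in>U. if v = w then c' [w, a] else 0)"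
        by (intro sum.cong) auto
      moreover have "w \<in> U" using US T' by auto
      ultimately show ?thesis using cyc'[of "[a]"] insert.prems(1) by simp
    qed
    \<comment> \<open>The other new edges of \<open>T\<close> each share an end with the new edge
      \<open>{x, y}\<close>, which already has value zero; \<open>kill\<close> applies at that
      end.\<close>
    have zx: "c' [z, x] = 0" if "{x, z} \<notin> K"
      using kill[of x y z] T xy zne that c'xy flip[of y x] by simp
    have "T = {y, x, z}" using T by auto
    then have zy: "c' [z, y] = 0" if "{y, z} \<notin> K"
      using kill[of y x z] xy zne that c'xy by (simp add: insert_commute)
    have "c' \<in> simplicial_chains K 1"
    proof (rule simplicial_chainsI)
      fix xs assume xs: "c' xs \<noteq> 0"
      then obtain p q where pq: "xs = [p, q]" "p \<noteq> q" "{p, q} \<in> L" by (rule chain1_list[OF c'])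
      have "{p, q} \<in> K"
      proof (rule ccontr)
        assume n: "{p, q} \<notin> K"
        then have "{p, q} \<subseteq> T" using pq(3) L_cases by blast
        then have "p \<in> {x, y, z}" "q \<in> {x, y, z}" using T by simp_all
        then consider "p = x" "q = y" | "p = y" "q = x" | "p = x" "q = z" | "p = z" "q = x"
          | "p = y" "q = z" | "p = z" "q = y" using pq(2) by blast
        then have "c' [p, q] = 0"
        proof cases
          case 1 then show ?thesis using c'xy by simp
        next
          case 2 then show ?thesis using c'xy flip[of q p] by simp
        next
          case 3 then show ?thesis using zx flip[of p q] n by simp
        next
          case 4 then show ?thesis using zx n by (simp add: insert_commute)
        next
          case 5 then show ?thesis using zy flip[of p q] n by simp
        next
          case 6 then show ?thesis using zy n by (simp add: insert_commute)
        qed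
        then show False using xs pq(1) by simp
      qed
      then show "distinct xs \<and> set xs \<in> K \<and> face_dim (set xs) = 1"
        using pq by (simp add: face_dim_def)
    qed (rule simplicial_chainsD(2)[OF c'])
    then obtain d' where d': "d' \<in> simplicial_chains K 2" "c' = (\<lambda>xs. \<Sum>v\<in>U. d' (v # xs))"
      using IH[OF insert.prems(1) US(1) _ cyc'] by blast
    define d where "d = (\<lambda>xs. d' xs + c [x, y] * ?t xs)"
    have "d \<in> simplicial_chains L 2"
      unfolding d_def using chains_mono[OF KL] d'(1) by (intro add_chain scale_chain t) blast
    moreover have "c = (\<lambda>xs. \<Sum>v\<in>U. d (v # xs))"
    proof
      fix xs
      have "(\<Sum>v\<in>U. d (v # xs)) = c' xs + c [x, y] * b xs"
        unfolding d_def sum.distrib sum_distrib_left[symmetric] tb by (simp add: d'(2))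
      then show "c xs = (\<Sum>v\<in>U. d (v # xs))" by (simp add: c'_def)
    qed
    ultimately show ?thesis by blast
  qed
  then show ?case unfolding L_def .
qed

lemma tshell_cycles_subset_boundaries:
  assumes "tshell S" "finite (\<Union>S)"
  shows "simplicial_cycles {X. \<exists>T\<in>S. X \<subseteq> T} 1 \<subseteq> simplicial_boundaries {X. \<exists>T\<in>S. X \<subseteq> T} 1"
proof
  let ?K = "{X. \<exists>T\<in>S. X \<subseteq> T}"
  have U: "\<Union>?K = \<Union>S" by blast
  fix c assume "c \<in> simplicial_cycles ?K 1"
  then have "c \<in> simplicial_chains ?K 1" "\<And>xs. (\<Sum>v\<in>\<Union>S. c (v # xs)) = 0"
    by (simp_all add: cycles_iff simplicial_boundary_def U)
  then obtain d where "d \<in> simplicial_chains ?K 2" "c = (\<lambda>xs. \<Sum>v\<in>\<Union>S. d (v # xs))"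
    using tshell_cycle_bounds[OF assms subset_refl] by blast
  then show "c \<in> simplicial_boundaries ?K 1"
    by (intro boundariesI[of d]) (simp_all add: simplicial_boundary_def U)
qed

text \<open>A 1-cocycle \<open>f\<close> vanishes on boundaries, so it vanishes on every triangle of edges if all
  1-cycles bound.\<close>

lemma cocycle_vanishes_on_cycle:
  fixes f :: "'a \<Rightarrow> 'a \<Rightarrow> int"
  assumes bounds: "simplicial_cycles K 1 \<subseteq> simplicial_boundaries K 1" and fin: "finite (\<Union>K)"
    and xyz: "{x, y} \<in> K" "{y, z} \<in> K" "{z, x} \<in> K" "x \<noteq> y" "y \<noteq> z" "z \<noteq> x"
    and anti: "\<And>p q. f q p = - f p q"
    and cocycle: "\<And>p q r. {p, q, r} \<in> K \<Longrightarrow> p \<noteq> q \<Longrightarrow> q \<noteq> r \<Longrightarrow> r \<noteq> p \<Longrightarrow> f p q + f q r + f r p = 0"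
  shows "f x y + f y z + f z x = 0"
proof -
  let ?U = "\<Union>K"
  define c where "c = (\<lambda>xs. edge_chain x y xs + edge_chain y z xs + edge_chain z x xs)"
  have U: "x \<in> ?U" "y \<in> ?U" "z \<in> ?U" using xyz by auto
  have "c \<in> simplicial_chains K 1"
    unfolding c_def using xyz by (intro add_chain edge_chain_in_chains) auto
  moreover have "simplicial_boundary K c xs = 0" for xs
    unfolding c_def simplicial_boundary_def using U xyz fin
    by (simp add: sum.distrib edge_chain_boundary)
  ultimately have "c \<in> simplicial_boundaries K 1" using bounds by (auto simp: cycles_iff)
  then obtain d where d: "d \<in> simplicial_chains K 2" "c = simplicial_boundary K d"
    unfolding simplicial_boundaries_def by auto
  have rot: "d [r, p, q] = d [p, q, r]" for p q r
    using simplicial_chainsD(2)[OF d(1), of "[]" r p "[q]"] simplicial_chainsD(2)[OF d(1), of "[p]" r q "[]"] by simp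
  \<comment> \<open>The pairing of \<open>f\<close> with the boundary of \<open>d\<close>, over all
    ordered triples. Rotating the triple gives two more expressions for it, and their total is a sum
    of cocycle relations.\<close>
  define S where "S = (\<Sum>p\<in>?U. \<Sum>q\<in>?U. \<Sum>r\<in>?U. f p q * d [r, p, q])"
  have S2: "S = (\<Sum>p\<in>?U. \<Sum>q\<in>?U. \<Sum>r\<in>?U. f q r * d [r, p, q])"
  proof -
    have "(\<Sum>p\<in>?U. \<Sum>q\<in>?U. \<Sum>r\<in>?U. f q r * d [r, p, q]) = (\<Sum>q\<in>?U. \<Sum>p\<in>?U. \<Sum>r\<in>?U. f q r * d [p, q, r])"
      by (subst sum.swap) (simp add: rot)
    also have "\<dots> = (\<Sum>q\<in>?U. \<Sum>r\<in>?U. \<Sum>p\<in>?U. f q r * d [p, q, r])"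
      by (rule sum.cong[OF refl], rule sum.swap)
    finally show ?thesis by (simp add: S_def)
  qed
  have S3: "S = (\<Sum>p\<in>?U. \<Sum>q\<in>?U. \<Sum>r\<in>?U. f r p * d [r, p, q])"
  proof -
    have "(\<Sum>p\<in>?U. \<Sum>q\<in>?U. \<Sum>r\<in>?U. f r p * d [r, p, q]) = (\<Sum>p\<in>?U. \<Sum>r\<in>?U. \<Sum>q\<in>?U. f r p * d [r, p, q])"
      by (rule sum.cong[OF refl], rule sum.swap)
    also have "\<dots> = (\<Sum>r\<in>?U. \<Sum>p\<in>?U. \<Sum>q\<in>?U. f r p * d [r, p, q])" by (rule sum.swap)
    also have "\<dots> = (\<Sum>r\<in>?U. \<Sum>p\<in>?U. \<Sum>q\<in>?U. f r p * d [q, r, p])" by (simp only: rot[symmetric])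
    finally show ?thesis by (simp add: S_def)
  qed
  have "3 * S = (\<Sum>p\<in>?U. \<Sum>q\<in>?U. \<Sum>r\<in>?U. f p q * d [r, p, q] + f q r * d [r, p, q] + f r p * d [r, p, q])"
    using S2 S3 unfolding sum.distrib S_def by linarith
  also have "\<dots> = 0"
  proof (intro sum.neutral ballI)
    fix p q r
    show "f p q * d [r, p, q] + f q r * d [r, p, q] + f r p * d [r, p, q] = 0"
    proof (cases "d [r, p, q] = 0")
      case False
      then have "distinct [r, p, q]" "{r, p, q} \<in> K" using simplicial_chainsD(1)[OF d(1) False] by auto
      then have "f p q + f q r + f r p = 0" by (intro cocycle) (auto simp: insert_commute)
      then show ?thesis by (metis distrib_right mult_zero_left)
    qed simp
  qed
  finally have "S = 0" by simp
  have "S = (\<Sum>p\<in>?U. \<Sum>q\<in>?U. f p q * c [p, q])"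
    unfolding S_def d(2) simplicial_boundary_def by (simp add: sum_distrib_left)
  \<comment> \<open>Each edge of the cycle occurs in both orders, with equal contributions since
    both \<open>f\<close> and the chain are antisymmetric.\<close>
  also have "\<dots> = 2 * (f x y + f y z + f z x)"
  proof -
    have "(\<Sum>p\<in>?U. \<Sum>q\<in>?U. f p q * edge_chain a b [p, q]) = 2 * f a b" if "a \<in> ?U" "b \<in> ?U" "a \<noteq> b" for a b
    proof -
      have "f p q * edge_chain a b [p, q] = (if q = b then if p = a then f a b else 0 else 0) + (if q = a then if p = b then f a b else 0 else 0)" for p q
        using that(3) anti[of a b] by (simp add: edge_chain_def)
      then show ?thesis using that fin by (simp add: sum.distrib)
    qed
    then show ?thesis using U xyz by (simp add: c_def distrib_left sum.distrib)
  qed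
  finally show ?thesis using \<open>S = 0\<close> by simp
qed

section \<open>Boolean representable complexes and their simplification\<close>

text \<open>In a unitriangular arrangement for \<open>X\<close> the first row has its 1 in the first
  column and zeros in all other columns of \<open>X\<close>. The zero set of a row of the matrix is
  a flat, and this one separates the first column from the rest.\<close>

lemma boolean_representable_separating_flat:
  assumes "simplicial_complex V H" "boolean_representable V H" and X: "X \<in> H" "X \<noteq> {}"
  shows "\<exists>x\<in>X. \<exists>F. is_flat V H F \<and> X - {x} \<subseteq> F \<and> x \<notin> F"
proof -
  obtain M :: "nat \<Rightarrow> 'a \<Rightarrow> bool" and R where H: "H = {X. X \<subseteq> V \<and> matrix_independent M R X}"
    using assms(2) unfolding boolean_representable_def by blast
  then obtain Y where Y: "Y \<subseteq> R" "nonsingular M Y X" "X \<subseteq> V"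
    using X unfolding matrix_independent_def by blast
  then obtain n r c where r: "bij_betw r {..<n::nat} Y" and c: "bij_betw c {..<n} X"
    and d: "\<forall>i<n. M (r i) (c i)" and u: "\<forall>i j. i < j \<and> j < n \<longrightarrow> \<not> M (r i) (c j)"
    unfolding nonsingular_def by blast
  have n: "n > 0" using X(2) c by (cases n) (auto simp: bij_betw_def)
  define Z where "Z = {v \<in> V. \<not> M (r 0) v}"
  have "is_flat V H Z"
    unfolding is_flat_def
  proof (intro conjI ballI impI)
    show "Z \<subseteq> V" by (auto simp: Z_def)
    fix I p assume I: "I \<in> H" "I \<subseteq> Z" and p: "p \<in> V - Z"
    then obtain Y' where Y': "Y' \<subseteq> R" "nonsingular M Y' I" using H unfolding matrix_independent_def by blast
    then obtain m r' c' where r': "bij_betw r' {..<m::nat} Y'" and c': "bij_betw c' {..<m} I"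
      and d': "\<forall>i<m. M (r' i) (c' i)" and u': "\<forall>i j. i < j \<and> j < m \<longrightarrow> \<not> M (r' i) (c' j)"
      unfolding nonsingular_def by blast
    have c'Z: "\<not> M (r 0) (c' i)" if "i < m" for i
      using that c' I by (auto simp: bij_betw_def Z_def)
    \<comment> \<open>Every row of \<open>Y'\<close> has a diagonal 1 in some column of
      \<open>I\<close>, whereas row \<open>r 0\<close> vanishes on \<open>I\<close>.\<close>
    have r0: "r 0 \<notin> Y'" using r' d' c'Z by (auto simp: bij_betw_def)
    have pI: "p \<notin> I" using p I by blast
    \<comment> \<open>Row \<open>r 0\<close> and column \<open>p\<close> are put in front; the new
      first row is 1 at \<open>p\<close> and 0 on \<open>I\<close>, so the matrix remains lower
      unitriangular.\<close>
    define r2 where "r2 = (\<lambda>i. case i of 0 \<Rightarrow> r 0 | Suc j \<Rightarrow> r' j)"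
    define c2 where "c2 = (\<lambda>i. case i of 0 \<Rightarrow> p | Suc j \<Rightarrow> c' j)"
    have split0: "{..<Suc m} = insert 0 (Suc ` {..<m})" by (simp add: lessThan_Suc_eq_insert_0)
    have neq: "r' i \<noteq> r 0" "c' i \<noteq> p" if "i < m" for i
      using that r0 pI r' c' unfolding bij_betw_def by (metis imageI lessThan_iff)+
    have "bij_betw r2 {..<Suc m} (insert (r 0) Y')"
      using r' neq(1) neq(1)[THEN not_sym] unfolding bij_betw_def split0 r2_def
      by (auto simp: inj_on_def image_image)
    moreover have "bij_betw c2 {..<Suc m} (insert p I)"
      using c' neq(2) neq(2)[THEN not_sym] unfolding bij_betw_def split0 c2_def
      by (auto simp: inj_on_def image_image)
    moreover have "M (r2 i) (c2 i)" if "i < Suc m" for i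
      using that d' p by (cases i) (auto simp: r2_def c2_def Z_def)
    moreover have "\<not> M (r2 i) (c2 j)" if "i < j" "j < Suc m" for i j
      using that u' c'Z by (cases i; cases j) (auto simp: r2_def c2_def)
    ultimately have "nonsingular M (insert (r 0) Y') (insert p I)"
      unfolding nonsingular_def by blast
    moreover have "r 0 \<in> R" using r n Y by (auto simp: bij_betw_def)
    ultimately have "matrix_independent M R (insert p I)"
      using Y'(1) unfolding matrix_independent_def by blast
    then show "I \<union> {p} \<in> H" using H I(1) p by auto
  qed
  moreover have "c 0 \<in> X" "M (r 0) (c 0)" using c n d by (auto simp: bij_betw_def)
  moreover have "X - {c 0} \<subseteq> Z"
  proof
    fix x assume x: "x \<in> X - {c 0}"
    then obtain j where "j < n" "x = c j" using c by (auto simp: bij_betw_def)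
    then show "x \<in> Z" using x Y(3) u[rule_format, of 0 j] by (cases j) (auto simp: Z_def)
  qed
  ultimately show ?thesis by (intro bexI[of _ "c 0"] exI[of _ Z]) (auto simp: Z_def)
qed

text \<open>A vertex lies in a nontrivial component iff it has a neighbour. As \<open>E\<close> is
  nonempty, some component is nontrivial, so the left side fails iff there are at least three
  components, at least two of them nontrivial; \<open>x\<close>, \<open>y\<close>, \<open>z\<close>
  represent three such components.\<close>

lemma components_iff:
  assumes fin: "finite V" and E: "E \<subseteq> V \<times> V" "sym E" "\<And>p. (p, p) \<notin> E" "E \<noteq> {}"
  shows "card (graph_components V E) \<le> 2 \<or> card (nontrivial_components V E) = 1 \<longleftrightarrow>
    \<not> (\<exists>x y z. x \<in> V \<and> y \<in> V \<and> z \<in> V \<and> x \<in> Domain E \<and> y \<in> Domain E \<and>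
       (x, y) \<notin> E\<^sup>* \<and> (x, z) \<notin> E\<^sup>* \<and> (y, z) \<notin> E\<^sup>*)" (is "?L \<longleftrightarrow> \<not> ?B")
proof -
  define R where "R = {(p, q). p \<in> V \<and> q \<in> V \<and> (p, q) \<in> E\<^sup>*}"
  have eq: "equiv V R"
    using sym_rtrancl[OF E(2)]
    unfolding R_def equiv_def refl_on_def sym_def trans_def by auto
  have gc: "graph_components V E = V // R" by (simp add: graph_components_def R_def)
  have finC: "finite (V // R)" using fin eq by (simp add: finite_quotient equiv_type)
  have nt: "R `` {x} \<in> nontrivial_components V E \<longleftrightarrow> x \<in> Domain E" if x: "x \<in> V" for x
  proof
    assume "R `` {x} \<in> nontrivial_components V E"
    then have "card (R `` {x}) > 1" by (simp add: nontrivial_components_def)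
    then have "\<not> R `` {x} \<subseteq> {x}" using card_mono[of "{x}" "R `` {x}"] by auto
    then obtain y where "(x, y) \<in> E\<^sup>*" "y \<noteq> x" by (auto simp: R_def)
    then show "x \<in> Domain E" by (auto elim: converse_rtranclE)
  next
    assume "x \<in> Domain E"
    then obtain y where y: "(x, y) \<in> E" by blast
    then have "{x, y} \<subseteq> R `` {x}" "x \<noteq> y" using E x by (auto simp: R_def)
    moreover have "finite (R `` {x})" using fin by (auto simp: R_def intro: finite_subset[of _ V])
    ultimately have "card (R `` {x}) > 1" using card_mono[of "R `` {x}" "{x, y}"] by simp
    then show "R `` {x} \<in> nontrivial_components V E"
      using x by (auto simp: nontrivial_components_def gc quotientI)
  qed
  have neq: "R `` {x} \<noteq> R `` {y} \<longleftrightarrow> (x, y) \<notin> E\<^sup>*" if "x \<in> V" "y \<in> V" for x y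
    using eq_equiv_class_iff[OF eq that] that by (auto simp: R_def)
  have ntsub: "nontrivial_components V E \<subseteq> V // R" by (auto simp: nontrivial_components_def gc)
  have finN: "finite (nontrivial_components V E)" using finC ntsub finite_subset by blast
  have "\<not> ?L" if ?B
  proof -
    from that obtain x y z where *: "x \<in> V" "y \<in> V" "z \<in> V" "x \<in> Domain E" "y \<in> Domain E"
       "(x, y) \<notin> E\<^sup>*" "(x, z) \<notin> E\<^sup>*" "(y, z) \<notin> E\<^sup>*" by blast
    let ?c = "\<lambda>x. R `` {x}"
    have "card {?c x, ?c y, ?c z} = 3" "card {?c x, ?c y} = 2" using * neq by auto
    moreover have "{?c x, ?c y, ?c z} \<subseteq> V // R" "{?c x, ?c y} \<subseteq> nontrivial_components V E"
      using * nt by (auto intro: quotientI)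
    ultimately have "card (V // R) \<ge> 3" "card (nontrivial_components V E) \<ge> 2"
      using card_mono finC finN by metis+
    then show ?thesis by (simp add: gc)
  qed
  moreover have ?B if "\<not> ?L"
  proof -
    obtain x0 where "x0 \<in> V" "x0 \<in> Domain E" using E by fast
    then have "nontrivial_components V E \<noteq> {}" using nt by blast
    then have "card (nontrivial_components V E) \<noteq> 0" using finN by simp
    then have "card (nontrivial_components V E) \<ge> 2" using that by linarith
    then obtain C D where CD: "C \<in> nontrivial_components V E" "D \<in> nontrivial_components V E" "C \<noteq> D"
      by (metis card_le_Suc0_iff_eq finN not_less_eq_eq numeral_2_eq_2)
    have "\<not> V // R \<subseteq> {C, D}"
    proof
      assume "V // R \<subseteq> {C, D}"
      then have "card (V // R) \<le> card {C, D}" by (intro card_mono) auto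
      then show False using that CD(3) by (simp add: gc)
    qed
    then obtain G where G: "G \<in> V // R" "G \<noteq> C" "G \<noteq> D" by blast
    obtain x y z where "x \<in> V" "C = R `` {x}" "y \<in> V" "D = R `` {y}" "z \<in> V" "G = R `` {z}"
      using G CD ntsub by (meson quotientE subsetD)
    moreover then have "x \<in> Domain E" "y \<in> Domain E" using CD nt by blast+
    moreover have "(x, y) \<notin> E\<^sup>*" "(x, z) \<notin> E\<^sup>*" "(y, z) \<notin> E\<^sup>*"
      using calculation CD(3) G neq by metis+
    ultimately show ?B by blast
  qed
  ultimately show ?thesis by blast
qed

text \<open>Boolean representability enters in the form of separating flats: every nonempty face has
  a vertex that some flat separates from the others.\<close>

locale br_complex =
  fixes V :: "'a set" and H :: "'a set set"
  assumes complex: "simplicial_complex V H"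
    and separating_flat: "\<And>X. X \<in> H \<Longrightarrow> X \<noteq> {} \<Longrightarrow> \<exists>x\<in>X. \<exists>F. is_flat V H F \<and> X - {x} \<subseteq> F \<and> x \<notin> F"
begin

abbreviation cl :: "'a set \<Rightarrow> 'a set" where "cl \<equiv> flat_closure V H"
abbreviation cls :: "'a \<Rightarrow> 'a set" where "cls p \<equiv> eta V H `` {p}"
abbreviation VS :: "'a set set" where "VS \<equiv> simplification_vertices V H"
abbreviation HS :: "'a set set set" where "HS \<equiv> simplification_faces V H"
abbreviation GS :: "('a set \<times> 'a set) set" where "GS \<equiv> graph_of_flats VS HS"

text \<open>The edges of the graph of flats of the simplification, pulled back to \<open>V\<close>:
  for distinct vertices, being a face amounts to having distinct classes.\<close>

definition adj :: "'a \<Rightarrow> 'a \<Rightarrow> bool" where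
  "adj p q \<longleftrightarrow> {p, q} \<in> H \<and> p \<noteq> q \<and> cl {p, q} \<noteq> V"

text \<open>Paths are taken between classes, so equivalent vertices are connected even when they
  have no neighbours.\<close>

definition conn :: "'a \<Rightarrow> 'a \<Rightarrow> bool" where
  "conn p q \<longleftrightarrow> (cls p, cls q) \<in> GS\<^sup>*"

section \<open>Flats, closures and the equivalence eta\<close>

lemma finite_V: "finite V" and face_subset: "X \<in> H \<Longrightarrow> X \<subseteq> V" and face_vertex: "v \<in> V \<Longrightarrow> {v} \<in> H"
  and face_down: "I \<in> H \<Longrightarrow> J \<subseteq> I \<Longrightarrow> J \<in> H"
  using complex unfolding simplicial_complex_def by blast+

lemma finite_face: "X \<in> H \<Longrightarrow> finite X"
  using face_subset finite_V finite_subset by blast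

lemma flat_extend: "is_flat V H F \<Longrightarrow> I \<in> H \<Longrightarrow> I \<subseteq> F \<Longrightarrow> p \<in> V \<Longrightarrow> p \<notin> F \<Longrightarrow> insert p I \<in> H"
  unfolding is_flat_def by (metis DiffI Un_insert_right sup_bot_right)

lemma subset_cl: "X \<subseteq> cl X" by (auto simp: flat_closure_def)

lemma cl_least: "is_flat V H F \<Longrightarrow> X \<subseteq> F \<Longrightarrow> cl X \<subseteq> F" by (auto simp: flat_closure_def)

lemma is_flat_cl:
  assumes "X \<subseteq> V" shows "is_flat V H (cl X)"
proof -
  have "is_flat V H V" by (simp add: is_flat_def)
  then have "cl X \<subseteq> V" using assms by (rule cl_least)
  moreover have "insert p I \<in> H" if "I \<in> H" "I \<subseteq> cl X" "p \<in> V" "p \<notin> cl X" for I p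
  proof -
    obtain F where "is_flat V H F" "X \<subseteq> F" "p \<notin> F" using \<open>p \<notin> cl X\<close> unfolding flat_closure_def by blast
    then show ?thesis using that cl_least by (intro flat_extend[of F]) blast+
  qed
  ultimately show ?thesis unfolding is_flat_def by auto
qed

lemma flat_eta: "is_flat V H F \<Longrightarrow> (p, q) \<in> eta V H \<Longrightarrow> p \<in> F \<Longrightarrow> q \<in> F"
  using cl_least[of F "{p}"] subset_cl[of "{q}"] by (auto simp: eta_def)

text \<open>A flat that contains \<open>p\<close> but not \<open>q\<close> extends the face
  \<open>{p}\<close> to \<open>{p, q}\<close>, so the two ends of a non-face lie in the same flats.
  Conversely, the separating flat of an edge contains exactly one of its ends.\<close>

lemma eta_iff: "(p, q) \<in> eta V H \<longleftrightarrow> p \<in> V \<and> q \<in> V \<and> (p = q \<or> {p, q} \<notin> H)"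
proof
  assume e: "(p, q) \<in> eta V H"
  then have e': "(q, p) \<in> eta V H" by (auto simp: eta_def)
  have "{p, q} \<notin> H" if "p \<noteq> q"
  proof
    assume "{p, q} \<in> H"
    then obtain x F where "x \<in> {p, q}" "is_flat V H F" "{p, q} - {x} \<subseteq> F" "x \<notin> F"
      using separating_flat[of "{p, q}"] by blast
    then show False using flat_eta[OF _ e] flat_eta[OF _ e'] that by blast
  qed
  then show "p \<in> V \<and> q \<in> V \<and> (p = q \<or> {p, q} \<notin> H)" using e by (auto simp: eta_def)
next
  assume *: "p \<in> V \<and> q \<in> V \<and> (p = q \<or> {p, q} \<notin> H)"
  have "p \<in> F \<longleftrightarrow> q \<in> F" if "is_flat V H F" for F
    using flat_extend[OF that, of "{p}" q] flat_extend[OF that, of "{q}" p] face_vertex *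
    by (auto simp: insert_commute)
  then have "cl {p} = cl {q}" unfolding flat_closure_def by (intro arg_cong[of _ _ Inter]) auto
  then show "(p, q) \<in> eta V H" using * by (simp add: eta_def)
qed

lemma equiv_eta: "equiv V (eta V H)"
  by (auto simp: equiv_def refl_on_def sym_def trans_def eta_def)

lemma cls_eq_iff: "p \<in> V \<Longrightarrow> q \<in> V \<Longrightarrow> cls p = cls q \<longleftrightarrow> (p, q) \<in> eta V H"
  by (rule eq_equiv_class_iff[OF equiv_eta])

text \<open>Flats are unions of classes. Hence the flat that separates \<open>x\<close> from the
  rest of \<open>I\<close> also separates \<open>s x\<close> from the replaced rest, which is a face
  by induction, and adding \<open>s x\<close> to it gives a face.\<close>

lemma face_replace_eta:
  "I \<in> H \<Longrightarrow> (\<And>i. i \<in> I \<Longrightarrow> (i, s i) \<in> eta V H) \<Longrightarrow> s ` I \<in> H"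
proof (induction "card I" arbitrary: I rule: less_induct)
  case less
  show ?case
  proof (cases "I = {}")
    case False
    then obtain x F where x: "x \<in> I" "is_flat V H F" "I - {x} \<subseteq> F" "x \<notin> F"
      using separating_flat less.prems by blast
    have "I - {x} \<in> H" using less.prems(1) by (rule face_down) auto
    moreover have "card (I - {x}) < card I" using x finite_face[OF less.prems(1)] by (intro psubset_card_mono) auto
    ultimately have "s ` (I - {x}) \<in> H" using less by blast
    moreover have "s ` (I - {x}) \<subseteq> F" using x less.prems(2) flat_eta by blast
    moreover have "s x \<notin> F"
      using flat_eta[OF x(2), of "s x" x] x less.prems(2)[of x] by (auto simp: eta_def)
    moreover have "s x \<in> V" using less.prems(2)[of x] x by (auto simp: eta_def)
    ultimately have "insert (s x) (s ` (I - {x})) \<in> H" using flat_extend[OF x(2)] by blast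
    then show ?thesis using x(1) by (metis image_insert insert_Diff)
  qed (use less in simp)
qed

section \<open>Passage to the simplification\<close>

lemma VS_eq: "VS = cls ` V" by (auto simp: simplification_vertices_def quotient_def)

lemma HS_eq: "HS = (\<lambda>I. cls ` I) ` H"
proof -
  have "I // eta V H = cls ` I" for I by (auto simp: quotient_def)
  then show ?thesis by (simp add: simplification_faces_def quotient_faces_def)
qed

text \<open>A face of the simplification comes from one system of representatives in
  \<open>H\<close>; replacing these by the equivalent elements of \<open>X\<close> keeps it a
  face.\<close>

lemma image_cls_in_HS_iff:
  assumes "X \<subseteq> V" "inj_on cls X"
  shows "cls ` X \<in> HS \<longleftrightarrow> X \<in> H"
proof
  assume "cls ` X \<in> HS"
  then obtain I where I: "I \<in> H" "cls ` X = cls ` I" by (auto simp: HS_eq)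
  define s where "s = (\<lambda>i. inv_into X cls (cls i))"
  have "(i, s i) \<in> eta V H" if "i \<in> I" for i
  proof -
    have "cls i \<in> cls ` X" using I that by blast
    then have "cls (s i) = cls i" "s i \<in> X" unfolding s_def by (rule f_inv_into_f, rule inv_into_into)
    moreover have "i \<in> V" using face_subset I that by blast
    ultimately show ?thesis using cls_eq_iff assms(1) by blast
  qed
  then have "s ` I \<in> H" using face_replace_eta I by blast
  moreover have "s ` I = inv_into X cls ` cls ` I" by (simp only: s_def image_image)
  then have "s ` I = X" by (simp only: I(2)[symmetric] inv_into_image_cancel[OF assms(2) subset_refl])
  ultimately show "X \<in> H" by simp
qed (auto simp: HS_eq)

lemma inj_on_cls_face: "X \<in> H \<Longrightarrow> inj_on cls X"
proof (rule inj_onI)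
  fix p q assume X: "X \<in> H" and pq: "p \<in> X" "q \<in> X" "cls p = cls q"
  then have "(p, q) \<in> eta V H" using face_subset[OF X] by (intro iffD1[OF cls_eq_iff]) auto
  moreover have "{p, q} \<in> H" using X pq by (intro face_down[OF X]) auto
  ultimately show "p = q" by (simp add: eta_iff)
qed

lemma cls_in_image_flat_iff: "is_flat V H F \<Longrightarrow> p \<in> V \<Longrightarrow> cls p \<in> cls ` F \<longleftrightarrow> p \<in> F"
proof
  assume F: "is_flat V H F" and p: "p \<in> V" and "cls p \<in> cls ` F"
  then obtain q where q: "q \<in> F" "cls p = cls q" by blast
  moreover have "q \<in> V" using F q by (auto simp: is_flat_def)
  ultimately have "(q, p) \<in> eta V H" using p cls_eq_iff by metis
  then show "p \<in> F" using flat_eta[OF F _ q(1)] by blast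
qed auto

lemma is_flat_image_cls:
  assumes F: "is_flat V H F"
  shows "is_flat VS HS (cls ` F)"
  unfolding is_flat_def
proof (intro conjI ballI impI)
  show "cls ` F \<subseteq> VS" using F by (auto simp: is_flat_def VS_eq)
  fix J c assume J: "J \<in> HS" "J \<subseteq> cls ` F" and c: "c \<in> VS - cls ` F"
  from c obtain p where p: "p \<in> V" "c = cls p" "p \<notin> F" by (auto simp: VS_eq)
  from J obtain I where I: "I \<in> H" "J = cls ` I" by (auto simp: HS_eq)
  then have "I \<subseteq> F" using J(2) cls_in_image_flat_iff[OF F] face_subset by blast
  then have "insert p I \<in> H" using flat_extend[OF F] I p by blast
  then show "J \<union> {c} \<in> HS" using I p by (auto simp: HS_eq intro!: image_eqI[of _ _ "insert p I"])
qed

lemma is_flat_vimage_cls: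
  assumes F: "is_flat VS HS F"
  shows "is_flat V H {p \<in> V. cls p \<in> F}"
  unfolding is_flat_def
proof (intro conjI ballI impI)
  fix I p assume I: "I \<in> H" "I \<subseteq> {p \<in> V. cls p \<in> F}" and p: "p \<in> V - {p \<in> V. cls p \<in> F}"
  have "cls ` I \<in> HS" using I by (auto simp: HS_eq)
  moreover have "cls ` I \<subseteq> F" "cls p \<in> VS - F" using I p by (auto simp: VS_eq)
  ultimately have "cls ` I \<union> {cls p} \<in> HS" using F unfolding is_flat_def by blast
  then have "cls ` (insert p I) \<in> HS" by simp
  \<comment> \<open>The class of \<open>p\<close> is outside \<open>F\<close> and the classes of
    \<open>I\<close> are inside, so \<open>p\<close> is equivalent to no vertex of
    \<open>I\<close>.\<close>
  moreover have "inj_on cls (insert p I)" using inj_on_cls_face[OF I(1)] I p by (auto simp: inj_on_insert)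
  ultimately show "I \<union> {p} \<in> H" using image_cls_in_HS_iff[of "insert p I"] I p face_subset by auto
qed auto

text \<open>Images and preimages under \<open>cls\<close> carry flats to flats, so a proper flat
  through the two vertices on one side gives a proper flat on the other.\<close>

lemma flat_closure_simplification_iff:
  assumes "p \<in> V" "q \<in> V"
  shows "flat_closure VS HS {cls p, cls q} = VS \<longleftrightarrow> cl {p, q} = V"
proof
  assume *: "flat_closure VS HS {cls p, cls q} = VS"
  have fl: "is_flat V H (cl {p, q})" using assms by (intro is_flat_cl) auto
  have "flat_closure VS HS {cls p, cls q} \<subseteq> cls ` cl {p, q}"
    using is_flat_image_cls[OF fl] subset_cl[of "{p, q}"] unfolding flat_closure_def[of VS HS] by blast
  then have "cls ` V \<subseteq> cls ` cl {p, q}" using * by (simp add: VS_eq)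
  then have "V \<subseteq> cl {p, q}" using cls_in_image_flat_iff[OF fl] by blast
  then show "cl {p, q} = V" using fl by (auto simp: is_flat_def)
next
  assume *: "cl {p, q} = V"
  have "F = VS" if F: "is_flat VS HS F" "{cls p, cls q} \<subseteq> F" for F
  proof -
    have "cl {p, q} \<subseteq> {p \<in> V. cls p \<in> F}" using F assms by (intro cl_least is_flat_vimage_cls) auto
    then show ?thesis using * F by (auto simp: VS_eq is_flat_def)
  qed
  moreover have "is_flat VS HS VS" by (auto simp: is_flat_def)
  ultimately show "flat_closure VS HS {cls p, cls q} = VS" using assms
    unfolding flat_closure_def by (auto simp: VS_eq)
qed

lemma GS_iff:
  assumes "p \<in> V" "q \<in> V"
  shows "(cls p, cls q) \<in> GS \<longleftrightarrow> adj p q"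
  using assms flat_closure_simplification_iff[OF assms] cls_eq_iff[OF assms]
  by (auto simp: graph_of_flats_def adj_def eta_iff VS_eq)

lemma GS_subset: "GS \<subseteq> VS \<times> VS" by (auto simp: graph_of_flats_def)

lemma sym_GS: "sym GS" by (auto simp: graph_of_flats_def sym_def insert_commute)

section \<open>Adjacency and connectedness on the original vertex set\<close>

lemma conn_sym: "conn p q \<Longrightarrow> conn q p"
  unfolding conn_def using sym_rtrancl[OF sym_GS] by (auto dest: symD)

lemma conn_trans: "conn p q \<Longrightarrow> conn q r \<Longrightarrow> conn p r"
  unfolding conn_def by simp

lemma conn_refl: "conn p p" by (simp add: conn_def)

lemma adj_sym: "adj p q \<Longrightarrow> adj q p" by (auto simp: adj_def insert_commute)

lemma adj_vertex: assumes "adj p q" shows "p \<in> V" "q \<in> V"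
  using assms face_subset[of "{p, q}"] by (auto simp: adj_def)

lemma adj_conn: "adj p q \<Longrightarrow> conn p q"
  unfolding conn_def using GS_iff adj_vertex by blast

lemma adj_eta: "adj p q \<Longrightarrow> (p, p') \<in> eta V H \<Longrightarrow> adj p' q"
  using GS_iff[of p q] GS_iff[of p' q] cls_eq_iff[of p p'] adj_vertex[of p q] by (auto simp: eta_iff)

text \<open>A path between classes lifts to \<open>V\<close> step by step, since adjacency depends
  only on the classes. The neighbour \<open>x'\<close> serves the start of the path: a vertex
  equivalent to \<open>x\<close> need not be adjacent to \<open>x\<close>, but it is reached from
  \<open>x\<close> through \<open>x'\<close>.\<close>

lemma conn_closed:
  assumes X: "\<And>p q. p \<in> X \<Longrightarrow> adj p q \<Longrightarrow> q \<in> X" and x: "x \<in> X" "adj x x'"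
    and z: "conn x z" "z \<in> V"
  shows "z \<in> X"
proof -
  have "\<forall>q. q \<in> V \<and> cls q = Q \<longrightarrow> q \<in> X" if "(cls x, Q) \<in> GS\<^sup>*" for Q
    using that
  proof (induction rule: rtrancl_induct)
    case base
    show ?case
    proof (intro allI impI)
      fix q assume q: "q \<in> V \<and> cls q = cls x"
      then have "adj q x'" using adj_eta[OF x(2), of q] cls_eq_iff adj_vertex[OF x(2)] by metis
      then show "q \<in> X" using X[OF X[OF x]] adj_sym by blast
    qed
  next
    case (step Q R)
    show ?case
    proof (intro allI impI)
      fix r assume r: "r \<in> V \<and> cls r = R"
      obtain q where q: "q \<in> V" "Q = cls q" using step(2) GS_subset VS_eq by blast
      then have "adj q r" using GS_iff[of q r] step(2) r by simp
      then show "r \<in> X" using X step.IH q by blast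
    qed
  qed
  then show ?thesis using z by (auto simp: conn_def)
qed

end

section \<open>Dimension 2\<close>

locale br_complex_dim2 = br_complex +
  assumes card_face_le: "X \<in> H \<Longrightarrow> card X \<le> 3"
    and ex_triangle: "\<exists>T\<in>H. card T = 3"
begin

definition Tri :: "'a set set" where "Tri = {T \<in> H. card T = 3}"

text \<open>A point \<open>r\<close> of \<open>F\<close> outside the closure of
  \<open>{p, q}\<close> would make \<open>{p, q, r}\<close> a face inside \<open>F\<close>, and a
  point outside \<open>F\<close> would extend it to a face with four vertices.\<close>

lemma flat_eq_cl:
  assumes F: "is_flat V H F" "F \<noteq> V" and pq: "p \<in> F" "q \<in> F" "{p, q} \<in> H" "p \<noteq> q"
  shows "F = cl {p, q}"
proof
  show "cl {p, q} \<subseteq> F" using F pq by (intro cl_least) auto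
  show "F \<subseteq> cl {p, q}"
  proof
    fix r assume r: "r \<in> F"
    have FV: "F \<subseteq> V" using F by (simp add: is_flat_def)
    show "r \<in> cl {p, q}"
    proof (rule ccontr)
      assume n: "r \<notin> cl {p, q}"
      then have rpq: "r \<noteq> p" "r \<noteq> q" using subset_cl[of "{p, q}"] by auto
      have "is_flat V H (cl {p, q})" using FV pq by (intro is_flat_cl) auto
      then have "insert r {p, q} \<in> H" using pq(3) subset_cl[of "{p, q}"] r n FV by - (rule flat_extend, auto)
      moreover obtain s where s: "s \<in> V" "s \<notin> F" using F FV by blast
      ultimately have "insert s {r, p, q} \<in> H" using pq r by - (rule flat_extend[OF F(1)], auto)
      moreover have "s \<notin> {r, p, q}" using pq r s by blast
      then have "card (insert s {r, p, q}) = 4" using rpq pq(4) by simp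
      ultimately show False using card_face_le[of "insert s {r, p, q}"] by simp
    qed
  qed
qed

lemma adj_in_flat:
  assumes "is_flat V H F" "F \<noteq> V" "p \<in> F" "q \<in> F" "{p, q} \<in> H" "p \<noteq> q"
  shows "adj p q"
  using flat_eq_cl[OF assms] assms by (simp add: adj_def)

lemma adj_cl: assumes "adj p q" shows "is_flat V H (cl {p, q})" "cl {p, q} \<noteq> V"
  "p \<in> cl {p, q}" "q \<in> cl {p, q}"
  using assms is_flat_cl[of "{p, q}"] adj_vertex[OF assms] subset_cl[of "{p, q}"] by (auto simp: adj_def)

lemma adj_triangle:
  assumes "adj p q" "r \<in> V" "r \<notin> cl {p, q}"
  shows "{p, q, r} \<in> Tri"
proof -
  have "insert r {p, q} \<in> H" using assms adj_cl[OF assms(1)] by - (rule flat_extend, auto simp: adj_def)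
  moreover have "r \<noteq> p" "r \<noteq> q" using assms(3) subset_cl[of "{p, q}"] by auto
  ultimately show ?thesis using assms(1) by (auto simp: Tri_def adj_def insert_commute)
qed

text \<open>The separating flat of a triangle omits one vertex, so it is proper, and the other two
  vertices are adjacent inside it.\<close>

lemma triangle_adj:
  assumes "T \<in> Tri"
  obtains p q r where "T = {p, q, r}" "adj p q" "r \<in> V" "r \<notin> cl {p, q}"
proof -
  have T: "T \<in> H" "card T = 3" using assms by (auto simp: Tri_def)
  then have "T \<noteq> {}" by auto
  then obtain r F where r: "r \<in> T" "is_flat V H F" "T - {r} \<subseteq> F" "r \<notin> F"
    using separating_flat T by blast
  have "card (T - {r}) = 2" using r T finite_face by simp
  then obtain p q where pq: "T - {r} = {p, q}" "p \<noteq> q" by (auto simp: card_2_iff)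
  have "{p, q} \<in> H" using T(1) pq face_down[of T "T - {r}"] by auto
  have rV: "r \<in> V" using T r face_subset by blast
  moreover have "adj p q" using adj_in_flat[OF r(2), of p q] rV r pq \<open>{p, q} \<in> H\<close> by auto
  moreover have "T = {p, q, r}" using pq(1) r(1) by blast
  moreover have "r \<notin> cl {p, q}" using cl_least[OF r(2), of "{p, q}"] r pq by auto
  ultimately show ?thesis using that by blast
qed

lemma adj_cl_adj:
  assumes "adj p q" "{p, r} \<in> H" "p \<noteq> r" "r \<in> cl {p, q}"
  shows "adj p r" "cl {p, r} = cl {p, q}"
  using adj_in_flat[of "cl {p, q}" p r] flat_eq_cl[of "cl {p, q}" p r] adj_cl[OF assms(1)] assms by auto

lemma edge_vertices: "{p, q} \<in> H \<Longrightarrow> p \<in> V \<and> q \<in> V"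
  using face_subset by blast

lemma triangle_edges:
  assumes "{p, q, r} \<in> Tri"
  shows "{p, q} \<in> H" "{p, r} \<in> H" "{q, r} \<in> H" "p \<noteq> q" "p \<noteq> r" "q \<noteq> r"
proof -
  have T: "{p, q, r} \<in> H" "card {p, q, r} = 3" using assms by (auto simp: Tri_def)
  show "{p, q} \<in> H" "{p, r} \<in> H" "{q, r} \<in> H" by (rule face_down[OF T(1)]; blast)+
  show "p \<noteq> q" "p \<noteq> r" "q \<noteq> r" using T(2) by (auto simp: card_insert_if split: if_splits)
qed

text \<open>Within \<open>W\<close>, two vertices of the link of \<open>v\<close> are at distance at
  most two. If \<open>v\<close> is adjacent to \<open>x\<close>, then \<open>z\<close> is either off
  the line through \<open>v\<close> and \<open>x\<close>, or on it, and then any point of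
  \<open>W\<close> off this line is a common neighbour; the case of \<open>z\<close> is symmetric.
  If \<open>v\<close> is adjacent to neither, both lie off the line through \<open>v\<close> and
  \<open>n\<close>.\<close>

lemma link_diameter:
  assumes n: "n \<in> W" "adj v n" and W: "W \<subseteq> V" and nc: "\<And>F. is_flat V H F \<Longrightarrow> insert v W \<subseteq> F \<Longrightarrow> F = V"
    and x: "x \<in> W" "{v, x} \<in> H" "v \<noteq> x" and z: "z \<in> W" "{v, z} \<in> H" "v \<noteq> z"
  shows "{v, x, z} \<in> Tri \<or> (\<exists>y\<in>W. {v, x, y} \<in> Tri \<and> {v, y, z} \<in> Tri)"
proof (cases "adj v x")
  case True
  show ?thesis
  proof (cases "z \<in> cl {v, x}")
    case False
    then show ?thesis using adj_triangle[OF True] z W by blast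
  next
    case zin: True
    note vz = adj_cl_adj[OF True z(2,3) zin]
    obtain y where y: "y \<in> W" "y \<notin> cl {v, x}" using nc[of "cl {v, x}"] adj_cl[OF True] by blast
    then have "y \<in> V" using W by blast
    then have "{v, x, y} \<in> Tri" "{v, z, y} \<in> Tri"
      using adj_triangle[OF True] adj_triangle[OF vz(1)] y vz(2) by auto
    then show ?thesis using y by (auto simp: insert_commute)
  qed
next
  case False
  show ?thesis
  proof (cases "adj v z")
    case True
    then have "x \<notin> cl {v, z}" using False adj_cl_adj x by blast
    then have "{v, z, x} \<in> Tri" using adj_triangle[OF True] x W by blast
    then show ?thesis by (simp add: insert_commute)
  next
    case nz: False
    then have "x \<notin> cl {v, n}" "z \<notin> cl {v, n}" using False adj_cl_adj[OF n(2)] x z by blast+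
    then have "{v, n, x} \<in> Tri" "{v, n, z} \<in> Tri" using adj_triangle[OF n(2)] x z W by auto
    then show ?thesis using n by (auto simp: insert_commute)
  qed
qed

section \<open>Adding one vertex to a shelling of triangles\<close>

lemma card_Tri: "T \<in> Tri \<Longrightarrow> card T = 3" by (simp add: Tri_def)

lemma link_edge:
  assumes "insert v e \<in> Tri" "v \<notin> e"
  obtains a b where "e = {a, b}" "a \<noteq> b" "{v, a, b} \<in> Tri"
proof -
  have "finite e" using finite_face[of "insert v e"] assms by (simp add: Tri_def)
  then have "card e = 2" using card_Tri[OF assms(1)] assms(2) by simp
  then obtain a b where "e = {a, b}" "a \<noteq> b" by (auto simp: card_2_iff)
  then show ?thesis using that assms(1) by auto
qed

text \<open>The link of \<open>v\<close> within \<open>W\<close> has diameter at most two, hence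
  connected edges. The hypothesis \<open>inv\<close> gives each edge inside \<open>W\<close> an end
  with a neighbour in \<open>W\<close>; this is what places link edges in triangles already
  present.\<close>

lemma tshell_step_adj:
  assumes t: "tshell {T \<in> Tri. T \<subseteq> W}" and W: "W \<subseteq> V" and v: "v \<in> V" "v \<notin> W" and n: "n \<in> W" "adj v n"
    and nc: "\<And>F. is_flat V H F \<Longrightarrow> W \<subseteq> F \<Longrightarrow> F = V"
    and inv: "\<And>p q. p \<in> W \<Longrightarrow> q \<in> W \<Longrightarrow> {p, q} \<in> H \<Longrightarrow> p \<noteq> q \<Longrightarrow> \<exists>r\<in>W. adj p r \<or> adj q r"
  shows "tshell {T \<in> Tri. T \<subseteq> insert v W}"
proof (rule tshell_add_vertex[OF t card_Tri _ v(2) refl])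
  let ?E = "{e. e \<subseteq> W \<and> insert v e \<in> Tri}"
  show "finite W" using W finite_V finite_subset by blast
  have edge: "\<exists>a b. e = {a, b} \<and> a \<noteq> b \<and> {v, a, b} \<in> Tri" if "e \<in> ?E" for e
  proof -
    have "v \<notin> e" using that v by blast
    with that obtain a b where "e = {a, b}" "a \<noteq> b" "{v, a, b} \<in> Tri" by (blast elim: link_edge)
    then show ?thesis by blast
  qed
  show "\<exists>e\<in>?E - E'. \<exists>e'\<in>E'. e \<inter> e' \<noteq> {}" if E': "E' \<subseteq> ?E" "E' \<noteq> {}" "E' \<noteq> ?E" for E'
  proof (rule ccontr)
    assume apart: "\<not> (\<exists>e\<in>?E - E'. \<exists>e'\<in>E'. e \<inter> e' \<noteq> {})"
    have closed: "e \<in> E'" if e: "e \<in> ?E" "e' \<in> E'" "e \<inter> e' \<noteq> {}" for e e'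
    proof (rule ccontr)
      assume "e \<notin> E'"
      with e(1) have "e \<in> ?E - E'" by simp
      with apart e(2,3) show False by blast
    qed
    obtain e' where e': "e' \<in> E'" using E' by blast
    then obtain x x' where x: "e' = {x, x'}" "{v, x, x'} \<in> Tri" using edge E' by blast
    obtain e where e: "e \<in> ?E" "e \<notin> E'" using E' by blast
    then obtain z z' where z: "e = {z, z'}" "{v, z, z'} \<in> Tri" using edge by blast
    have xW: "x \<in> W" "z \<in> W" using x z e e' E' by auto
    have vx: "{v, x} \<in> H" "v \<noteq> x" "{v, z} \<in> H" "v \<noteq> z"
      using triangle_edges[OF x(2)] triangle_edges[OF z(2)] by auto
    have nc': "F = V" if "is_flat V H F" "insert v W \<subseteq> F" for F using nc that by blast
    \<comment> \<open>A path of at most two edges joins an edge of \<open>E'\<close> to one outside;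
      closure of \<open>E'\<close> under touching edges propagates along it.\<close>
    from link_diameter[OF n W nc' xW(1) vx(1,2) xW(2) vx(3,4)]
    consider "{v, x, z} \<in> Tri" | y where "y \<in> W" "{v, x, y} \<in> Tri" "{v, y, z} \<in> Tri" by blast
    then show False
    proof cases
      case 1
      then have "{x, z} \<in> E'" using closed[of "{x, z}" e'] e' x xW by auto
      then show False using closed[of e "{x, z}"] e z by auto
    next
      case 2
      then have "{x, y} \<in> E'" using closed[of "{x, y}" e'] e' x xW by auto
      then have "{y, z} \<in> E'" using closed[of "{y, z}" "{x, y}"] 2 xW by auto
      then show False using closed[of e "{y, z}"] e z by auto
    qed
  qed
  \<comment> \<open>If \<open>a\<close> and \<open>b\<close> are adjacent, a point of
    \<open>W\<close> off their line completes a triangle. Otherwise \<open>b\<close> is off the line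
    through \<open>a\<close> and \<open>r\<close>, and \<open>r\<close> itself is the third
    vertex.\<close>
  have old: "\<exists>c\<in>W. {a, b, c} \<in> Tri" if "a \<in> W" "b \<in> W" "{a, b} \<in> H" "a \<noteq> b" "r \<in> W" "adj a r" for a b r
  proof (cases "adj a b")
    case True
    obtain c where "c \<in> W" "c \<notin> cl {a, b}" using nc[of "cl {a, b}"] adj_cl[OF True] by blast
    then show ?thesis using adj_triangle[OF True] W by blast
  next
    case False
    then have "b \<notin> cl {a, r}" using adj_cl_adj that by blast
    then have "{a, r, b} \<in> Tri" using adj_triangle that W by blast
    then show ?thesis using that by (auto simp: insert_commute)
  qed
  show "\<exists>T\<in>Tri. T \<subseteq> W \<and> e \<subseteq> T" if e: "e \<in> ?E" for e
  proof -
    obtain a b where ab: "e = {a, b}" "a \<noteq> b" "{v, a, b} \<in> Tri" using edge[OF e] by blast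
    have abW: "a \<in> W" "b \<in> W" using ab e by auto
    have abH: "{a, b} \<in> H" using triangle_edges ab(3) by blast
    obtain r where r: "r \<in> W" "adj a r \<or> adj b r" using inv[OF abW abH ab(2)] by blast
    have "\<exists>c\<in>W. {a, b, c} \<in> Tri"
      using r old[OF abW abH ab(2)] old[OF abW(2,1), of r] abH ab(2) by (auto simp: insert_commute)
    then obtain c where "c \<in> W" "{a, b, c} \<in> Tri" by blast
    then show ?thesis using ab(1) abW by (intro bexI[of _ "{a, b, c}"]) simp_all
  qed
qed

text \<open>A point \<open>v\<close> on the line through \<open>a\<close> and \<open>b\<close> is
  either equivalent to \<open>a\<close>, hence adjacent to \<open>b\<close>, or forms an edge with
  \<open>a\<close> inside a proper flat, hence is adjacent to \<open>a\<close>.\<close>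

lemma isolated_notin_cl:
  assumes v: "v \<in> V" "\<And>q. \<not> adj v q" and "adj a b"
  shows "v \<notin> cl {a, b}"
proof
  assume vin: "v \<in> cl {a, b}"
  have "a \<noteq> v" using v assms(3) by blast
  moreover have "(a, v) \<notin> eta V H" using adj_eta[OF assms(3)] v by blast
  ultimately have "{a, v} \<in> H" using v adj_vertex[OF assms(3)] by (auto simp: eta_iff)
  then have "adj a v" using adj_cl_adj[OF assms(3) _ _ vin] \<open>a \<noteq> v\<close> by blast
  then show False using v adj_sym by blast
qed

text \<open>Every triangle contains an adjacent pair, which must avoid the isolated vertex
  \<open>v\<close>; conversely \<open>v\<close> lies off every line. So the link edges of
  \<open>v\<close> are the adjacent pairs.\<close>

lemma isolated_triangle_iff:
  assumes v: "v \<in> V" "\<And>q. \<not> adj v q"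
  shows "{v, a, b} \<in> Tri \<longleftrightarrow> adj a b"
proof
  assume T: "{v, a, b} \<in> Tri"
  then obtain p q r where pqr: "{v, a, b} = {p, q, r}" "adj p q" by (rule triangle_adj)
  have "p \<noteq> v" using pqr(2) v(2) by blast
  moreover have "q \<noteq> v" using adj_sym[OF pqr(2)] v(2) by blast
  moreover have "p \<noteq> q" using pqr(2) by (simp add: adj_def)
  moreover have "v \<noteq> a" "v \<noteq> b" "a \<noteq> b" using triangle_edges[OF T] by auto
  ultimately have "(p = a \<and> q = b) \<or> (p = b \<and> q = a)" using pqr(1) by blast
  then show "adj a b" using pqr adj_sym by blast
next
  assume "adj a b"
  then show "{v, a, b} \<in> Tri" using adj_triangle isolated_notin_cl[OF v] v by (metis insert_commute)
qed

text \<open>The link edges of \<open>v\<close> form the adjacency graph, connected outside isolated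
  vertices by \<open>connected\<close>. Each of them lies in an old triangle, because
  \<open>W\<close> has a point off its line.\<close>

lemma tshell_step_isolated:
  assumes t: "tshell {T \<in> Tri. T \<subseteq> W}" and W: "W \<subseteq> V" and v: "v \<in> V" "v \<notin> W" "\<And>q. \<not> adj v q"
    and sub: "\<And>p q. adj p q \<Longrightarrow> p \<in> W"
    and connected: "\<And>p q p' q'. adj p q \<Longrightarrow> adj p' q' \<Longrightarrow> conn p p'"
    and nc: "\<And>F. is_flat V H F \<Longrightarrow> W \<subseteq> F \<Longrightarrow> F = V"
  shows "tshell {T \<in> Tri. T \<subseteq> insert v W}"
proof (rule tshell_add_vertex[OF t card_Tri _ v(2) refl])
  let ?E = "{e. e \<subseteq> W \<and> insert v e \<in> Tri}"
  show "finite W" using W finite_V finite_subset by blast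
  have edge: "\<exists>a b. e = {a, b} \<and> adj a b" if "e \<in> ?E" for e
  proof -
    have "v \<notin> e" using that v by blast
    with that obtain a b where "e = {a, b}" "{v, a, b} \<in> Tri" by (blast elim: link_edge)
    then show ?thesis using isolated_triangle_iff[OF v(1,3)] by blast
  qed
  have edge': "{a, b} \<in> ?E" if "adj a b" for a b
    using that sub adj_sym isolated_triangle_iff[OF v(1,3)] by blast
  show "\<exists>e\<in>?E - E'. \<exists>e'\<in>E'. e \<inter> e' \<noteq> {}" if E': "E' \<subseteq> ?E" "E' \<noteq> {}" "E' \<noteq> ?E" for E'
  proof (rule ccontr)
    assume apart: "\<not> (\<exists>e\<in>?E - E'. \<exists>e'\<in>E'. e \<inter> e' \<noteq> {})"
    have closed: "e \<in> E'" if e: "e \<in> ?E" "e' \<in> E'" "e \<inter> e' \<noteq> {}" for e e'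
    proof (rule ccontr)
      assume "e \<notin> E'"
      with e(1) have "e \<in> ?E - E'" by simp
      with apart e(2,3) show False by blast
    qed
    obtain e' where e': "e' \<in> E'" using E' by blast
    then obtain x x' where x: "e' = {x, x'}" "adj x x'" using edge E' by blast
    obtain e where e: "e \<in> ?E" "e \<notin> E'" using E' by blast
    then obtain z z' where z: "e = {z, z'}" "adj z z'" using edge by blast
    \<comment> \<open>The vertices covered by \<open>E'\<close> are closed under adjacency, so they
      include the whole component of \<open>x\<close>.\<close>
    have "z \<in> \<Union>E'"
    proof (rule conn_closed[OF _ _ x(2)])
      show "q \<in> \<Union>E'" if "p \<in> \<Union>E'" "adj p q" for p q
        using that closed[OF edge'[OF that(2)]] by blast
      show "x \<in> \<Union>E'" using e' x by blast
      show "conn x z" using connected x z by blast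
      show "z \<in> V" using adj_vertex z by blast
    qed
    then show False using closed[OF e(1)] e z by blast
  qed
  show "\<exists>T\<in>Tri. T \<subseteq> W \<and> e \<subseteq> T" if e: "e \<in> ?E" for e
  proof -
    obtain a b where ab: "e = {a, b}" "adj a b" using edge[OF e] by blast
    obtain c where "c \<in> W" "c \<notin> cl {a, b}" using nc[of "cl {a, b}"] adj_cl[OF ab(2)] by blast
    then have "{a, b, c} \<in> Tri" "{a, b, c} \<subseteq> W" using adj_triangle[OF ab(2)] W e ab by auto
    then show ?thesis using ab by blast
  qed
qed

text \<open>Representatives of three components, those of \<open>x\<close> and \<open>y\<close>
  nontrivial: a witness against the component condition on the graph of flats.\<close>

definition bad_triple :: "'a \<Rightarrow> 'a \<Rightarrow> 'a \<Rightarrow> bool" where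
  "bad_triple x y z \<longleftrightarrow> x \<in> V \<and> y \<in> V \<and> z \<in> V \<and> (\<exists>x'. adj x x') \<and> (\<exists>y'. adj y y') \<and>
     \<not> conn x y \<and> \<not> conn x z \<and> \<not> conn y z"

section \<open>Shelling the triangles when there is no bad triple\<close>

lemma ex_max_subset:
  assumes "P W0" "W0 \<subseteq> V"
  shows "\<exists>W. P W \<and> W0 \<subseteq> W \<and> W \<subseteq> V \<and> (\<forall>v\<in>V - W. \<not> P (insert v W))"
proof -
  have "finite {W. W \<subseteq> V \<and> P W}" using finite_V by simp
  moreover have "W0 \<in> {W. W \<subseteq> V \<and> P W}" using assms by simp
  ultimately obtain W where W: "W \<in> {W. W \<subseteq> V \<and> P W}" "W0 \<subseteq> W"
    and mx: "\<forall>W'\<in>{W. W \<subseteq> V \<and> P W}. W \<subseteq> W' \<longrightarrow> W = W'"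
    using finite_has_maximal2[of "{W. W \<subseteq> V \<and> P W}" W0] by metis
  have "\<not> P (insert v W)" if "v \<in> V - W" for v
    using mx W(1) that by (metis (no_types, lifting) Diff_iff insertI1 insert_subset mem_Collect_eq subset_insertI)
  then show ?thesis using W by (intro exI[of _ W]) simp
qed

lemma no_bad_triple_imp_tshell:
  assumes nb: "\<And>x y z. \<not> bad_triple x y z"
  shows "tshell Tri"
proof -
  obtain T where "T \<in> Tri" using ex_triangle by (auto simp: Tri_def)
  then obtain a b c0 where abc0: "adj a b" "c0 \<in> V" "c0 \<notin> cl {a, b}" by (rule triangle_adj)
  have ab: "a \<in> V" "b \<in> V" using adj_vertex abc0 by auto
  \<comment> \<open>If there is a second nontrivial component, the third vertex of the initial
    triangle is taken from it, so that both components grow from this triangle.\<close>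
  obtain c where c: "c \<in> V" "c \<notin> cl {a, b}"
    and c': "(\<exists>c'. adj c c') \<and> \<not> conn a c \<or> (\<forall>y y'. adj y y' \<longrightarrow> conn a y)"
  proof (cases "\<forall>y y'. adj y y' \<longrightarrow> conn a y")
    case True
    then show ?thesis using that abc0 by blast
  next
    case False
    then obtain y y' where y: "adj y y'" "\<not> conn a y" by blast
    have "y \<notin> cl {a, b}"
    proof
      assume yin: "y \<in> cl {a, b}"
      have yV: "y \<in> V" using adj_vertex y by blast
      have "a \<noteq> y" using y conn_refl by auto
      moreover have "(a, y) \<notin> eta V H"
        using y(2) cls_eq_iff[OF ab(1) yV] by (auto simp: conn_def)
      ultimately have "{a, y} \<in> H" using yV ab by (auto simp: eta_iff)
      then have "adj a y" using adj_cl_adj[OF abc0(1) _ \<open>a \<noteq> y\<close> yin] by blast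
      then show False using adj_conn y by blast
    qed
    then show ?thesis using that y adj_vertex by blast
  qed
  \<comment> \<open>The invariant carried along with the shelling; it supplies the hypothesis
    \<open>inv\<close> of \<open>tshell_step_adj\<close>.\<close>
  define covers where "covers W \<longleftrightarrow> (\<forall>p\<in>W. \<forall>q\<in>W. {p, q} \<in> H \<and> p \<noteq> q \<longrightarrow> (\<exists>r\<in>W. adj p r \<or> adj q r))" for W
  have T: "{a, b, c} \<in> Tri" using adj_triangle abc0 c by blast
  have "{T \<in> Tri. T \<subseteq> {a, b, c}} = {{a, b, c}}"
  proof (intro subset_antisym subsetI)
    fix T' assume "T' \<in> {T \<in> Tri. T \<subseteq> {a, b, c}}"
    then have "T' = {a, b, c}" using card_Tri card_Tri[OF T] by (intro card_seteq) auto
    then show "T' \<in> {{a, b, c}}" by simp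
  qed (use T in auto)
  moreover have "tshell {{a, b, c}}"
    using tshell.insert[OF tshell.empty, of "{a, b, c}"] card_Tri[OF T] by simp
  moreover have "covers {a, b, c}" using abc0(1) adj_sym by (auto simp: covers_def)
  ultimately have P0: "tshell {T \<in> Tri. T \<subseteq> {a, b, c}} \<and> covers {a, b, c}" by simp
  have "{a, b, c} \<subseteq> V" using ab c(1) by blast
  then have "\<exists>W. (tshell {T \<in> Tri. T \<subseteq> W} \<and> covers W) \<and> {a, b, c} \<subseteq> W \<and> W \<subseteq> V \<and>
      (\<forall>v\<in>V - W. \<not> (tshell {T \<in> Tri. T \<subseteq> insert v W} \<and> covers (insert v W)))"
    by (rule ex_max_subset[of "\<lambda>W. tshell {T \<in> Tri. T \<subseteq> W} \<and> covers W", OF P0])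
  then obtain W where W: "tshell {T \<in> Tri. T \<subseteq> W}" "covers W" "{a, b, c} \<subseteq> W" "W \<subseteq> V"
    and mx: "\<forall>v\<in>V - W. \<not> (tshell {T \<in> Tri. T \<subseteq> insert v W} \<and> covers (insert v W))"
    by (elim exE conjE) (rule that)
  \<comment> \<open>The only proper flat through \<open>a\<close> and \<open>b\<close> is their
    line, and it misses \<open>c\<close>.\<close>
  have nc: "F = V" if "is_flat V H F" "W \<subseteq> F" for F
  proof (rule ccontr)
    assume "F \<noteq> V"
    moreover have "a \<in> F" "b \<in> F" using that(2) W(3) by auto
    moreover have "{a, b} \<in> H" "a \<noteq> b" using abc0(1) by (simp_all add: adj_def)
    ultimately have "F = cl {a, b}" by (rule flat_eq_cl[OF that(1)])
    then show False using c that W by blast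
  qed
  \<comment> \<open>A neighbour outside \<open>W\<close> could be added, against maximality; so
    \<open>W\<close> is a union of components apart from isolated vertices.\<close>
  have closed: "v \<in> W" if n: "n \<in> W" "adj n v" for n v
  proof (rule ccontr)
    assume vW: "v \<notin> W"
    have nv: "v \<in> V" "adj v n" using n adj_vertex adj_sym by blast+
    have "tshell {T \<in> Tri. T \<subseteq> insert v W}"
      using W(2) by (intro tshell_step_adj[OF W(1,4) nv(1) vW n(1) nv(2) nc]) (auto simp: covers_def)
    moreover have "covers (insert v W)" using W(2) nv(2) n(1) adj_sym unfolding covers_def by blast
    ultimately show False using mx vW nv by blast
  qed
  have reach: "z \<in> W" if "x \<in> W" "adj x x'" "conn x z" "z \<in> V" for x x' z
    using conn_closed[of W, OF closed that] .
  have "tshell {T \<in> Tri. T \<subseteq> V}"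
  proof (cases "\<forall>y y'. adj y y' \<longrightarrow> conn a y")
    case True
    \<comment> \<open>With a single nontrivial component \<open>W\<close> contains every vertex that
      has a neighbour, and only isolated vertices remain to be added.\<close>
    have sub: "p \<in> W" if "adj p q" for p q
      using reach[of a b p] W(3) abc0(1) True that adj_vertex by blast
    obtain U where U: "tshell {T \<in> Tri. T \<subseteq> U}" "W \<subseteq> U" "U \<subseteq> V"
      and mxU: "\<forall>v\<in>V - U. \<not> tshell {T \<in> Tri. T \<subseteq> insert v U}"
      using ex_max_subset[of "\<lambda>W. tshell {T \<in> Tri. T \<subseteq> W}", OF W(1,4)] by (elim exE conjE) (rule that)
    have "U = V"
    proof (rule ccontr)
      assume "U \<noteq> V"
      then obtain v where v: "v \<in> V" "v \<notin> U" using U by blast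
      have "tshell {T \<in> Tri. T \<subseteq> insert v U}"
      proof (rule tshell_step_isolated[OF U(1,3) v])
        show "\<not> adj v q" for q using sub v U by blast
        show "p \<in> U" if "adj p q" for p q using sub that U by blast
        show "conn p p'" if "adj p q" "adj p' q'" for p q p' q'
          using True that conn_sym conn_trans by blast
        show "F = V" if "is_flat V H F" "U \<subseteq> F" for F using nc that U by blast
      qed
      then show False using mxU v by blast
    qed
    then show ?thesis using U by simp
  next
    case False
    then obtain c'' where cc: "adj c c''" "\<not> conn a c" using c' by blast
    have "V \<subseteq> W"
    proof
      fix z assume z: "z \<in> V"
      \<comment> \<open>With \<open>a\<close> and \<open>c\<close> in two nontrivial components, a
        vertex in a third would complete a bad triple.\<close>
      then have "conn a z \<or> conn c z"
        using nb[of a c z] cc abc0(1) ab c(1) unfolding bad_triple_def by blast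
      then show "z \<in> W" using reach[OF _ abc0(1) _ z] reach[OF _ cc(1) _ z] W(3) by blast
    qed
    then show ?thesis using W by (simp add: subset_antisym)
  qed
  moreover have "{T \<in> Tri. T \<subseteq> V} = Tri" using face_subset by (auto simp: Tri_def)
  ultimately show ?thesis by simp
qed

text \<open>A vertex equivalent to \<open>a\<close> is adjacent to \<open>b\<close>; any other
  vertex distinct from \<open>a\<close> forms an edge with \<open>a\<close>.\<close>

lemma vertex_other:
  assumes "adj a b" "p \<in> V"
  shows "({a, p} \<in> H \<and> a \<noteq> p) \<or> ({b, p} \<in> H \<and> b \<noteq> p)"
proof (cases "(a, p) \<in> eta V H")
  case True
  then have "adj p b" using adj_eta assms by blast
  then show ?thesis by (auto simp: adj_def insert_commute)
next
  case False
  then show ?thesis using assms adj_vertex[OF assms(1)] by (auto simp: eta_iff)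
qed

text \<open>If \<open>p\<close> is on the line through \<open>a\<close> and \<open>b\<close>, a
  point off the line completes \<open>{a, p}\<close>; otherwise \<open>b\<close> does.\<close>

lemma adj_edge_in_triangle:
  assumes "adj a b" "{a, p} \<in> H" "a \<noteq> p"
  shows "\<exists>T\<in>Tri. {a, p} \<subseteq> T"
proof (cases "p \<in> cl {a, b}")
  case True
  then have "adj a p" using adj_cl_adj assms by blast
  moreover have "cl {a, p} \<subseteq> V" using adj_cl(1)[OF calculation] by (simp add: is_flat_def)
  ultimately obtain c where "c \<in> V" "c \<notin> cl {a, p}" using adj_cl(2)[of a p] by blast
  then show ?thesis using adj_triangle[OF \<open>adj a p\<close>] by blast
next
  case False
  then show ?thesis using adj_triangle[OF assms(1)] assms(2) edge_vertices by blast
qed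

lemma obtain_adj: obtains a b where "adj a b"
proof -
  obtain T where "T \<in> Tri" using ex_triangle unfolding Tri_def by blast
  then show ?thesis using that by (rule triangle_adj)
qed

lemma vertex_in_triangle:
  assumes "p \<in> V"
  shows "\<exists>T\<in>Tri. p \<in> T"
proof -
  obtain a b where "adj a b" by (rule obtain_adj)
  then show ?thesis
    using vertex_other[OF _ assms] adj_edge_in_triangle[of a b p] adj_edge_in_triangle[of b a p] adj_sym by blast
qed

section \<open>Reformulation of shellability and of the component condition\<close>

lemma ex_facet_superset: "X \<in> H \<Longrightarrow> \<exists>Y\<in>facets H. X \<subseteq> Y"
proof -
  assume "X \<in> H"
  moreover have "finite H" using finite_V face_subset by (auto intro: finite_subset[of _ "Pow V"])
  ultimately show ?thesis using finite_has_maximal2[of H X] by (auto simp: facets_def)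
qed

text \<open>Every vertex lies in a triangle, so the facets other than triangles are edges whose ends
  are covered by triangles, as appending them to a shelling demands.\<close>

lemma shellable_iff_tshell: "shellable H \<longleftrightarrow> tshell Tri"
proof
  have HV: "H \<subseteq> Pow V" using face_subset by blast
  show "tshell Tri" if "shellable H"
    using shellable_imp_tshell[OF that finite_V HV card_face_le ex_facet_superset] by (simp add: Tri_def)
  assume t: "tshell Tri"
  have "card X \<ge> 2" if X: "X \<in> facets H" for X
  proof (rule ccontr)
    assume "\<not> 2 \<le> card X"
    have XH: "X \<in> H" "finite X" using X finite_face by (auto simp: facets_def)
    have "\<exists>T\<in>Tri. X \<subseteq> T"
    proof (cases "X = {}")
      case True
      then show ?thesis using ex_triangle by (auto simp: Tri_def)
    next
      case False
      then have "card X \<noteq> 0" using XH by simp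
      then have "card X = 1" using \<open>\<not> 2 \<le> card X\<close> by linarith
      then obtain x where "X = {x}" by (auto simp: card_1_singleton_iff)
      then show ?thesis using vertex_in_triangle[of x] XH face_subset by auto
    qed
    then obtain T where "T \<in> Tri" "X \<subseteq> T" by blast
    then have "X = T" "card T = 3" using X by (auto simp: facets_def Tri_def)
    then show False using \<open>\<not> 2 \<le> card X\<close> by simp
  qed
  moreover have "\<exists>T\<in>H. card T = 3 \<and> v \<in> T" if "X \<in> facets H" "v \<in> X" for X v
    using vertex_in_triangle[of v] face_subset[of X] that by (auto simp: facets_def Tri_def)
  ultimately show "shellable H"
    using tshell_imp_shellable[OF t[unfolded Tri_def] finite_V HV card_face_le] by blast
qed

lemma components_condition_iff:
  "card (graph_components VS GS) \<le> 2 \<or> card (nontrivial_components VS GS) = 1 \<longleftrightarrow>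
     \<not> (\<exists>x y z. bad_triple x y z)"
proof -
  obtain a b where ab: "adj a b" by (rule obtain_adj)
  have dom: "cls x \<in> Domain GS \<longleftrightarrow> (\<exists>x'. adj x x')" if x: "x \<in> V" for x
  proof
    assume "cls x \<in> Domain GS"
    then obtain Q where "(cls x, Q) \<in> GS" by blast
    moreover then obtain q where "q \<in> V" "Q = cls q" using GS_subset VS_eq by blast
    ultimately show "\<exists>x'. adj x x'" using GS_iff[OF x] by blast
  next
    assume "\<exists>x'. adj x x'"
    then obtain x' where "adj x x'" by blast
    then have "(cls x, cls x') \<in> GS" using GS_iff adj_vertex by blast
    then show "cls x \<in> Domain GS" by blast
  qed
  have "GS \<noteq> {}" using GS_iff adj_vertex[OF ab] ab by blast
  moreover have "(p, p) \<notin> GS" for p by (simp add: graph_of_flats_def)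
  moreover have "finite VS" using finite_V by (simp add: VS_eq)
  ultimately have "card (graph_components VS GS) \<le> 2 \<or> card (nontrivial_components VS GS) = 1 \<longleftrightarrow>
    \<not> (\<exists>x y z. x \<in> VS \<and> y \<in> VS \<and> z \<in> VS \<and> x \<in> Domain GS \<and> y \<in> Domain GS \<and>
       (x, y) \<notin> GS\<^sup>* \<and> (x, z) \<notin> GS\<^sup>* \<and> (y, z) \<notin> GS\<^sup>*)"
    using components_iff[OF _ GS_subset sym_GS] by blast
  also have "(\<exists>x y z. x \<in> VS \<and> y \<in> VS \<and> z \<in> VS \<and> x \<in> Domain GS \<and> y \<in> Domain GS \<and>
       (x, y) \<notin> GS\<^sup>* \<and> (x, z) \<notin> GS\<^sup>* \<and> (y, z) \<notin> GS\<^sup>*) \<longleftrightarrow> (\<exists>x y z. bad_triple x y z)"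
    (is "?L \<longleftrightarrow> ?R")
  proof
    assume ?L
    then obtain x y z where xyz: "x \<in> VS" "y \<in> VS" "z \<in> VS" "x \<in> Domain GS" "y \<in> Domain GS"
      "(x, y) \<notin> GS\<^sup>*" "(x, z) \<notin> GS\<^sup>*" "(y, z) \<notin> GS\<^sup>*" by blast
    then obtain p q r where "p \<in> V" "q \<in> V" "r \<in> V" "x = cls p" "y = cls q" "z = cls r"
      unfolding VS_eq by blast
    then have "bad_triple p q r" using xyz dom unfolding bad_triple_def conn_def by simp
    then show ?R by blast
  next
    assume ?R
    then obtain p q r where pqr: "bad_triple p q r" by blast
    then have "cls p \<in> VS" "cls q \<in> VS" "cls r \<in> VS" by (auto simp: bad_triple_def VS_eq)
    moreover have "cls p \<in> Domain GS" "cls q \<in> Domain GS" using pqr dom unfolding bad_triple_def by blast+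
    moreover have "(cls p, cls q) \<notin> GS\<^sup>*" "(cls p, cls r) \<notin> GS\<^sup>*" "(cls q, cls r) \<notin> GS\<^sup>*"
      using pqr unfolding bad_triple_def conn_def by blast+
    ultimately show ?L by (intro exI conjI)
  qed
  finally show ?thesis .
qed

end

section \<open>Homology of the links and the main equivalence\<close>

lemma pure_part_down: "X \<in> pure_part m K \<Longrightarrow> Y \<subseteq> X \<Longrightarrow> Y \<in> pure_part m K"
  unfolding pure_part_def by blast

lemma edge_in_pure_part_1: "{p, q} \<in> K \<Longrightarrow> p \<noteq> q \<Longrightarrow> {p, q} \<in> pure_part 1 K"
  unfolding pure_part_def by (auto simp: face_dim_def intro!: bexI[of _ "{p, q}"])

lemma trivial_reduced_homology_pure_part_iff:
  "trivial_group (reduced_homology (pure_part m K) k) \<longleftrightarrow>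
     simplicial_cycles (pure_part m K) k \<subseteq> simplicial_boundaries (pure_part m K) k"
  by (rule trivial_reduced_homology_iff) (rule pure_part_down)

context br_complex_dim2
begin

lemma pure_part_2: "pure_part 2 H = {X. \<exists>T\<in>Tri. X \<subseteq> T}"
  by (auto simp: pure_part_def Tri_def face_dim_def)

lemma link_empty: "link V H {} = H"
  using face_subset by (auto simp: link_def)

lemma vertices_pure_link: "\<Union>(pure_part m (link V H X)) \<subseteq> V"
  by (auto simp: pure_part_def link_def)

text \<open>The vertices that have a neighbour are closed under adjacency.\<close>

lemma conn_adj_isolated:
  assumes "adj x x'" "conn x v" "v \<in> V"
  shows "\<exists>w. adj v w"
proof -
  have "v \<in> {p. \<exists>q. adj p q}"
    by (rule conn_closed[OF _ _ assms(1,2,3)]) (use assms(1) adj_sym in blast)+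
  then show ?thesis by simp
qed

lemma conn_face:
  assumes "\<not> conn x y" "x \<in> V" "y \<in> V"
  shows "{x, y} \<in> H \<and> x \<noteq> y"
proof -
  have "x \<noteq> y" using assms conn_refl by blast
  moreover have "(x, y) \<notin> eta V H" using assms cls_eq_iff[of x y] conn_refl unfolding conn_def by fastforce
  ultimately show ?thesis using assms by (simp add: eta_iff)
qed

text \<open>Every triangle has two vertices in the same component, so a function of the components of
  the two ends of an edge is a cocycle as soon as it is antisymmetric.\<close>

lemma bounding_imp_no_bad_triple:
  assumes "simplicial_cycles (pure_part 2 H) 1 \<subseteq> simplicial_boundaries (pure_part 2 H) 1"
  shows "\<not> bad_triple x y z"
proof
  assume "bad_triple x y z"
  then obtain x' y' where V: "x \<in> V" "y \<in> V" "z \<in> V" and x': "adj x x'" and y': "adj y y'"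
    and nc: "\<not> conn x y" "\<not> conn x z" "\<not> conn y z" unfolding bad_triple_def by blast
  \<comment> \<open>The signed count of edges from the component of \<open>x\<close> to that of
    \<open>y\<close>.\<close>
  define f :: "'a \<Rightarrow> 'a \<Rightarrow> int"
    where "f p q = of_bool (conn x p \<and> conn y q) - of_bool (conn y p \<and> conn x q)" for p q
  have face: "{x, y} \<in> H" "x \<noteq> y" "{x, z} \<in> H" "x \<noteq> z" "{y, z} \<in> H" "y \<noteq> z"
    using conn_face nc V by blast+
  have edges: "{x, y} \<in> pure_part 2 H" "{x, z} \<in> pure_part 2 H" "{y, z} \<in> pure_part 2 H"
    using adj_edge_in_triangle[OF x' face(1,2)] adj_edge_in_triangle[OF x' face(3,4)]
      adj_edge_in_triangle[OF y' face(5,6)] unfolding pure_part_2 by auto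
  have fin: "finite (\<Union>(pure_part 2 H))"
    using vertices_pure_link[of 2 "{}"] finite_V finite_subset unfolding link_empty by blast
  have cocycle: "f p q + f q r + f r p = 0" if pqr: "{p, q, r} \<in> pure_part 2 H" "p \<noteq> q" "q \<noteq> r" "r \<noteq> p" for p q r
  proof -
    obtain T where T: "T \<in> Tri" "{p, q, r} \<subseteq> T" using pqr(1) unfolding pure_part_2 by blast
    have "card T = 3" by (rule card_Tri[OF T(1)])
    moreover then have "finite T" by (intro card_ge_0_finite) simp
    ultimately have "{p, q, r} = T" using T(2) pqr(2-4) by (intro card_seteq) auto
    then have Teq: "T = {p, q, r}" by simp
    obtain a b w where "T = {a, b, w}" "adj a b" using T(1) by (rule triangle_adj)
    then have "a \<in> {p, q, r}" "b \<in> {p, q, r}" "a \<noteq> b" using Teq by (auto simp: adj_def)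
    moreover have "conn a b" "conn b a" using adj_conn conn_sym \<open>adj a b\<close> by blast+
    ultimately have "conn p q \<or> conn q r \<or> conn r p" using conn_sym by blast
    moreover have same: "conn u s \<longleftrightarrow> conn u t" if "conn s t" for u s t
      using that conn_trans conn_sym by blast
    have excl: "\<not> (conn x s \<and> conn y s)" for s using nc(1) conn_trans conn_sym by blast
    \<comment> \<open>Along the connected pair \<open>f\<close> vanishes, and the two edges to the
      third vertex contribute opposite values.\<close>
    have two: "f s t + f t u + f u s = 0" if "conn s t" for s t u
    proof -
      note st = same[OF that, of x] same[OF that, of y]
      have "f s t = 0" unfolding f_def st using excl[of t] by simp
      moreover have "f u s = - f t u" unfolding f_def st by (simp add: conj_commute)
      ultimately show ?thesis by simp
    qed
    ultimately show ?thesis using two[of p q r] two[of q r p] two[of r p q] by linarith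
  qed
  have "f x y + f y z + f z x = 0"
  proof (rule cocycle_vanishes_on_cycle[OF assms fin edges(1,3) _ face(2,6)])
    show "{z, x} \<in> pure_part 2 H" using edges(2) by (simp add: insert_commute)
    show "z \<noteq> x" using face(4) by simp
    show "f q p = - f p q" for p q unfolding f_def by (simp add: conj_commute)
  qed (rule cocycle)
  moreover have "f x y = 1" "f y z = 0" "f z x = 0"
    using nc conn_refl[of x] conn_refl[of y] conn_sym by (auto simp: f_def)
  ultimately show False by simp
qed

lemma SCM_imp_bounding:
  assumes "sequentially_Cohen_Macaulay V H" "sc_dim H = 2"
  shows "simplicial_cycles (pure_part 2 H) 1 \<subseteq> simplicial_boundaries (pure_part 2 H) 1"
proof -
  have "{} \<in> H" using ex_triangle face_down by blast
  then have "trivial_group (reduced_homology (pure_part 2 (link V H {})) 1)"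
    using assms unfolding sequentially_Cohen_Macaulay_def by auto
  then show ?thesis unfolding link_empty trivial_reduced_homology_pure_part_iff .
qed

text \<open>Every vertex is joined by an edge to one of two adjacent vertices \<open>a\<close> and
  \<open>b\<close>, and edges at these lie in triangles, so the 1-skeleton stays connected in the
  pure 2-skeleton as well.\<close>

lemma pure_skeleton_cycles_zero:
  assumes m: "m = 1 \<or> m = 2"
  shows "simplicial_cycles (pure_part m H) 0 \<subseteq> simplicial_boundaries (pure_part m H) 0"
proof -
  obtain a b where ab: "adj a b" by (rule obtain_adj)
  have edge: "{c, p} \<in> pure_part m H" if "adj c d" "{c, p} \<in> H" "c \<noteq> p" for c d p
    using m adj_edge_in_triangle[OF that] edge_in_pure_part_1[OF that(2,3)] by (auto simp: pure_part_2)
  have abH: "{a, b} \<in> H" "a \<noteq> b" using ab by (auto simp: adj_def)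
  have PV: "\<Union>(pure_part m H) \<subseteq> V" using vertices_pure_link[of m "{}"] by (simp add: link_empty)
  show ?thesis
  proof (rule cycles_subset_boundaries_zero)
    show "Y \<in> pure_part m H" if "X \<in> pure_part m H" "Y \<subseteq> X" for X Y using that by (rule pure_part_down)
    show "finite (\<Union>(pure_part m H))" using PV finite_V by (rule finite_subset)
    show "a \<in> \<Union>(pure_part m H)" using edge[OF ab abH] by blast
    fix X assume X: "a \<in> X" and step: "\<And>p q. p \<in> X \<Longrightarrow> {p, q} \<in> pure_part m H \<Longrightarrow> p \<noteq> q \<Longrightarrow> q \<in> X"
    have "b \<in> X" using step[OF X edge[OF ab abH] abH(2)] .
    show "\<Union>(pure_part m H) \<subseteq> X"
    proof
      fix p assume "p \<in> \<Union>(pure_part m H)"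
      then have "p \<in> V" using PV by blast
      from vertex_other[OF ab this] show "p \<in> X"
        using step[OF X edge[OF ab]] step[OF \<open>b \<in> X\<close> edge[OF adj_sym[OF ab]]] by blast
    qed
  qed
qed

section \<open>Connectedness of the links and sequential Cohen-Macaulayness\<close>

lemma vertex_link_edge:
  assumes "{v, p, q} \<in> Tri"
  shows "{p, q} \<in> pure_part 1 (link V H {v})"
proof (rule edge_in_pure_part_1)
  show "p \<noteq> q" using triangle_edges[OF assms] by blast
  have "{v, p, q} \<in> H" using assms by (simp add: Tri_def)
  then show "{p, q} \<in> link V H {v}"
    using triangle_edges(4,5)[OF assms] face_subset[of "{v, p, q}"] by (auto simp: link_def insert_commute)
qed

lemma vertex_link_vertex:
  assumes "z \<in> \<Union>(pure_part 1 (link V H {v}))"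
  obtains z' where "{v, z, z'} \<in> Tri"
proof -
  obtain F where F: "F \<in> link V H {v}" "card F = 2" "z \<in> F"
    using assms by (auto simp: pure_part_def face_dim_def)
  then obtain z' where z': "F = {z, z'}" "z \<noteq> z'" by (auto simp: card_2_iff doubleton_eq_iff)
  have "F \<union> {v} \<in> H" "v \<notin> F" using F by (auto simp: link_def)
  then have "{v, z, z'} \<in> Tri" using z' by (auto simp: Tri_def insert_commute)
  then show ?thesis using that by blast
qed

text \<open>If \<open>v\<close> has a neighbour, \<open>link_diameter\<close> with
  \<open>W = V - {v}\<close> joins any two vertices of the link. If \<open>v\<close> is isolated,
  the link is the adjacency graph, and \<open>v\<close> lies in a component of its own; two link
  vertices in different components would form a bad triple with \<open>v\<close>.\<close>

lemma vertex_link_connected: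
  assumes nb: "\<And>x y z. \<not> bad_triple x y z" and v: "v \<in> V"
    and x: "x \<in> \<Union>(pure_part 1 (link V H {v}))" "x \<in> X"
    and step: "\<And>p q. p \<in> X \<Longrightarrow> {p, q} \<in> pure_part 1 (link V H {v}) \<Longrightarrow> p \<noteq> q \<Longrightarrow> q \<in> X"
  shows "\<Union>(pure_part 1 (link V H {v})) \<subseteq> X"
proof
  fix z assume "z \<in> \<Union>(pure_part 1 (link V H {v}))"
  then obtain z' where z: "{v, z, z'} \<in> Tri" by (rule vertex_link_vertex)
  obtain x' where x': "{v, x, x'} \<in> Tri" using x(1) by (rule vertex_link_vertex)
  have step': "q \<in> X" if "p \<in> X" "{v, p, q} \<in> Tri" for p q
    using step[OF that(1) vertex_link_edge[OF that(2)]] triangle_edges(6)[OF that(2)] by blast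
  note xe = triangle_edges[OF x'] and ze = triangle_edges[OF z]
  have xzV: "x \<in> V" "z \<in> V" using xe(1) ze(1) edge_vertices by blast+
  show "z \<in> X"
  proof (cases "\<exists>n. adj v n")
    case True
    then obtain n where n: "adj v n" by blast
    have "n \<in> V - {v}" using n adj_vertex by (auto simp: adj_def)
    moreover have "F = V" if "is_flat V H F" "insert v (V - {v}) \<subseteq> F" for F
      using that by (auto simp: is_flat_def)
    ultimately have "{v, x, z} \<in> Tri \<or> (\<exists>y\<in>V - {v}. {v, x, y} \<in> Tri \<and> {v, y, z} \<in> Tri)"
      using n xzV xe ze by (intro link_diameter[of n]) auto
    then show ?thesis using step' x(2) by blast
  next
    case False
    then have iso: "\<And>q. \<not> adj v q" by blast
    have adj: "adj x x'" "adj z z'" using isolated_triangle_iff[OF v iso] x' z by blast+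
    have "\<not> conn x v" "\<not> conn z v" using conn_adj_isolated adj iso v by blast+
    then have "conn x z" using nb[of x z v] adj xzV v unfolding bad_triple_def by blast
    moreover have "q \<in> X" if "p \<in> X" "adj p q" for p q
      using step'[OF that(1)] isolated_triangle_iff[OF v iso] that(2) by blast
    ultimately show ?thesis using conn_closed[of X x x' z] x(2) adj(1) xzV(2) by blast
  qed
qed

lemma no_bad_triple_imp_SCM:
  assumes nb: "\<And>x y z. \<not> bad_triple x y z" and dim: "sc_dim H = 2"
    and bounding: "simplicial_cycles (pure_part 2 H) 1 \<subseteq> simplicial_boundaries (pure_part 2 H) 1"
  shows "sequentially_Cohen_Macaulay V H"
  unfolding sequentially_Cohen_Macaulay_def
proof (intro ballI allI impI)
  fix X and k m :: int assume X: "X \<in> H" and km: "k < m \<and> m \<le> sc_dim H"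
  let ?K = "pure_part m (link V H X)"
  have finK: "finite (\<Union>?K)" using vertices_pure_link finite_V finite_subset by blast
  have "simplicial_cycles ?K k \<subseteq> simplicial_boundaries ?K k"
  proof (cases "k \<le> - 2 \<or> ?K = {}")
    case True
    then show ?thesis by (intro cycles_subset_boundaries_no_face) (auto simp: face_dim_def)
  next
    case False
    then obtain F where F: "F \<in> link V H X" "face_dim F = m" by (auto simp: pure_part_def)
    then have FX: "F \<inter> X = {}" "F \<union> X \<in> H" by (auto simp: link_def)
    then have "card F + card X \<le> 3"
      using card_face_le[OF FX(2)] finite_face[OF FX(2)] by (simp add: card_Un_disjoint)
    moreover have "card F = nat (m + 1)" using F by (simp add: face_dim_def)
    moreover have finX: "finite X" using finite_face X by blast
    \<comment> \<open>A face \<open>F\<close> with \<open>m + 1\<close> vertices in the link of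
      \<open>X\<close> requires \<open>m + 1 + card X \<le> 3\<close>, which together with
      \<open>k < m\<close> leaves these cases.\<close>
    ultimately consider "k = - 1" "m \<ge> 0" | "k = 0" "m = 1 \<or> m = 2" "X = {}" | "k = 0" "m = 1" "card X = 1" | "k = 1" "m = 2" "X = {}"
      using False km dim by (cases "card X = 0") fastforce+
    then show ?thesis
    proof cases
      case 1
      then have "F \<noteq> {}" using F by (auto simp: face_dim_def)
      moreover have "F \<in> ?K" using F by (auto simp: pure_part_def)
      ultimately obtain v where "v \<in> \<Union>?K" by blast
      then show ?thesis
        unfolding 1(1) using pure_part_down by (intro cycles_subset_boundaries_minus_one[OF _ finK])
    next
      case 2
      have "?K = pure_part m H" using 2 link_empty by simp
      then show ?thesis using pure_skeleton_cycles_zero[OF 2(2)] 2(1) by simp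
    next
      case 3
      then obtain v where v: "X = {v}" by (auto simp: card_1_singleton_iff)
      have vV: "v \<in> V" using X v face_subset by blast
      have "F \<noteq> {}" using F 3 by (auto simp: face_dim_def)
      moreover have "F \<in> ?K" using F by (auto simp: pure_part_def)
      ultimately obtain x where "x \<in> \<Union>?K" by blast
      then have x: "x \<in> \<Union>(pure_part 1 (link V H {v}))" using 3 v by simp
      show ?thesis
        unfolding 3(1,2) v
      proof (rule cycles_subset_boundaries_zero)
        show "Y \<in> pure_part 1 (link V H {v})" if "X \<in> pure_part 1 (link V H {v})" "Y \<subseteq> X" for X Y
          using that by (rule pure_part_down)
        show "finite (\<Union>(pure_part 1 (link V H {v})))" using finK 3(2) v by simp
      qed (fact x, rule vertex_link_connected[OF nb vV x])
    next
      case 4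
      then show ?thesis using bounding link_empty by simp
    qed
  qed
  then show "trivial_group (reduced_homology ?K k)"
    unfolding trivial_reduced_homology_pure_part_iff .
qed

lemma tshell_imp_bounding:
  assumes "tshell Tri"
  shows "simplicial_cycles (pure_part 2 H) 1 \<subseteq> simplicial_boundaries (pure_part 2 H) 1"
proof -
  have "\<Union>Tri \<subseteq> V" using face_subset by (auto simp: Tri_def)
  then show ?thesis unfolding pure_part_2
    using finite_V finite_subset by (intro tshell_cycles_subset_boundaries[OF assms]) blast
qed

end

theorem theorem5p2:
  fixes V :: "'a set" and H :: "'a set set"
    and V\<^sub>S :: "'a set set" and \<Gamma> :: "('a set \<times> 'a set) set"
  assumes "simplicial_complex V H"
    and "boolean_representable V H"
    and "sc_dim H = 2"
  defines "V\<^sub>S \<equiv> simplification_vertices V H"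
    and "\<Gamma> \<equiv> graph_of_flats (simplification_vertices V H) (simplification_faces V H)"
  shows "(shellable H \<longleftrightarrow> sequentially_Cohen_Macaulay V H) \<and>
         (sequentially_Cohen_Macaulay V H \<longleftrightarrow>
            card (graph_components V\<^sub>S \<Gamma>) \<le> 2 \<or> card (nontrivial_components V\<^sub>S \<Gamma>) = 1)"
proof -
  have "H \<subseteq> Pow V" "finite V" "H \<noteq> {}" using assms(1) unfolding simplicial_complex_def by auto
  then have finH: "finite H" by (auto intro: finite_subset)
  have card_le: "card X \<le> 3" if "X \<in> H" for X
  proof -
    have "face_dim X \<le> sc_dim H" unfolding sc_dim_def using finH that by (intro Max_ge) auto
    then show ?thesis using assms(3) by (simp add: face_dim_def)
  qed
  have "Max (face_dim ` H) \<in> face_dim ` H" using finH \<open>H \<noteq> {}\<close> by (intro Max_in) auto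
  then have "\<exists>T\<in>H. card T = 3" using assms(3) by (auto simp: sc_dim_def face_dim_def)
  interpret br_complex_dim2 V H
  proof
    show "simplicial_complex V H" by fact
    show "\<exists>x\<in>X. \<exists>F. is_flat V H F \<and> X - {x} \<subseteq> F \<and> x \<notin> F" if "X \<in> H" "X \<noteq> {}" for X
      using boolean_representable_separating_flat[OF assms(1,2) that] .
  qed fact+
  \<comment> \<open>All conditions are compared with shellability of the triangles. The
    Cohen-Macaulay condition at the empty face makes the 1-cycles bound, which excludes bad triples,
    and this yields a shelling; a shelling in turn makes the 1-cycles bound.\<close>
  have SCM_tshell: "tshell Tri" if "sequentially_Cohen_Macaulay V H"
    using no_bad_triple_imp_tshell[OF bounding_imp_no_bad_triple[OF SCM_imp_bounding[OF that assms(3)]]] .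
  have nb: "\<not> bad_triple x y z" if "tshell Tri" for x y z
    using bounding_imp_no_bad_triple[OF tshell_imp_bounding[OF that]] .
  have "sequentially_Cohen_Macaulay V H" if "tshell Tri"
    using no_bad_triple_imp_SCM[OF nb[OF that] assms(3) tshell_imp_bounding[OF that]] .
  then have "sequentially_Cohen_Macaulay V H \<longleftrightarrow> tshell Tri" using SCM_tshell by blast
  moreover have "tshell Tri \<longleftrightarrow> \<not> (\<exists>x y z. bad_triple x y z)"
    using nb no_bad_triple_imp_tshell by blast
  ultimately show ?thesis
    unfolding V\<^sub>S_def \<Gamma>_def components_condition_iff shellable_iff_tshell by simp
qed

end
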